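(* Let $n\ge 2$ and $\sigma>0$. There is a Borel probability measure $P$ on the space of norms $(\mathcal{K}_0,\delta^h)$ with the following properties: (1) every neighborhood has positive measure, i.e. $P(U)>0$ for every nonempty open set $U\subset\mathcal{K}_0$; (2) the set of polytopes in $\mathcal{K}_0$ has $P$-measure zero; (3) the set of smooth bodies in $\mathcal{K}_0$ has $P$-measure $1$; (4) the pushforward $(\alpha_0)_*P$ has truncated normal distribution on the interval $[\frac12,1)$, i.e. it is the normal distribution with mean $\frac12$ and variance $\left(\frac{\sigma}{2}\right)^2$ truncated to $[\frac12,1)$.
   Context: $V$ is a real $n$-dimensional Euclidean space with origin $O$. A convex body is a compact convex subset of $V$ with nonempty interior. $\mathcal{K}_0$ (the space of norms) is the set of convex bodies that are centrally symmetric about $O$ (each is the unit ball of a norm on $V$), with the Hausdorff metric $\delta^h$ and its Borel $\sigma$-algebra. A convex body is smooth if it has a unique supporting hyperplane at each boundary point. For a convex body $K$, $d(K)$ is its Euclidean diameter, $w(K)$ its (minimal) width, i.e. the smallest distance between two parallel supporting hyperplanes, and $\alpha_0(K):=\frac{d(K)}{w(K)+d(K)}\in[\frac12,1)$ is its thinness. The pushforward is $(\alpha_0)_*P(B)=P(\alpha_0^{-1}(B))$. The normal distribution with mean $\frac12$ and variance $(\frac{\sigma}{2})^2$ truncated to $[\frac12,1)$ is the probability distribution on $[\frac12,1)$ giving $[\frac12,c]$ the mass $\frac{\Phi\left((2c-1)/\sigma\right)-\Phi(0)}{\Phi(1/\sigma)-\Phi(0)}$ for $c\in[\frac12,1)$,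 where $\Phi$ is the standard normal distribution function. *)

theory Defs
  imports "HOL-Probability.Probability"
begin

definition convex_body :: "'a::euclidean_space set \<Rightarrow> bool" where
  "convex_body K \<longleftrightarrow> compact K \<and> convex K \<and> interior K \<noteq> {}"

definition norm_bodies :: "'a::euclidean_space set set" where
  "norm_bodies = {K. convex_body K \<and> uminus ` K = K}"

text \<open>The value outside the nonempty bounded sets is irrelevant; it is fixed to be \<open>0\<close> because
  the locale \<^locale>\<open>Metric_space\<close> wants a distance that is total, symmetric and nonnegative.\<close>

definition hausdorff_distance :: "'a::metric_space set \<Rightarrow> 'a set \<Rightarrow> real" where
  "hausdorff_distance A B =
    (if A = {} \<or> B = {} \<or> \<not> bounded A \<or> \<not> bounded B then 0
     else max (SUP a\<in>A. infdist a B) (SUP b\<in>B. infdist b A))"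

lemma hausdorff_distance_commute: "hausdorff_distance A B = hausdorff_distance B A"
  by (auto simp: hausdorff_distance_def max.commute)

lemma bdd_above_infdist:
  fixes A :: "'a::metric_space set"
  assumes "bounded A"
  shows "bdd_above ((\<lambda>a. infdist a B) ` A)"
proof (cases "A = {}")
  case False
  then obtain x where x: "x \<in> A" by blast
  obtain e where e: "\<And>y. y \<in> A \<Longrightarrow> dist x y \<le> e"
    using assms bounded_any_center[of A x] by blast
  show ?thesis
  proof (rule bdd_aboveI2)
    fix a assume "a \<in> A"
    then show "infdist a B \<le> infdist x B + e"
      using infdist_triangle[of a B x] e[of a] by (simp add: dist_commute)
  qed
qed simp

lemma infdist_le_hausdorff_distance:
  assumes "a \<in> A" "B \<noteq> {}" "bounded A" "bounded B"
  shows "infdist a B \<le> hausdorff_distance A B"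
proof -
  have "infdist a B \<le> (SUP a\<in>A. infdist a B)"
    by (rule cSUP_upper[OF assms(1) bdd_above_infdist[OF assms(3)]])
  then show ?thesis using assms by (auto simp: hausdorff_distance_def)
qed

lemma hausdorff_distance_le:
  assumes "A \<noteq> {}" "B \<noteq> {}" "bounded A" "bounded B"
    and "\<And>a. a \<in> A \<Longrightarrow> infdist a B \<le> r" "\<And>b. b \<in> B \<Longrightarrow> infdist b A \<le> r"
  shows "hausdorff_distance A B \<le> r"
  using assms by (auto simp: hausdorff_distance_def intro!: cSUP_least)

lemma hausdorff_distance_nonneg: "0 \<le> hausdorff_distance A B"
proof (cases "A = {} \<or> B = {} \<or> \<not> bounded A \<or> \<not> bounded B")
  case True
  then show ?thesis unfolding hausdorff_distance_def by (simp only: if_True)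
next
  case False
  then obtain a where "a \<in> A" by blast
  with False show ?thesis
    using infdist_le_hausdorff_distance[of a A B] infdist_nonneg[of a B] by linarith
qed

lemma infdist_le_infdist_hausdorff:
  assumes "A \<noteq> {}" "B \<noteq> {}" "bounded A" "bounded B"
  shows "infdist x B \<le> infdist x A + hausdorff_distance A B"
proof -
  have "infdist x B - hausdorff_distance A B \<le> infdist x A"
    unfolding infdist_notempty[OF assms(1)]
  proof (rule cINF_greatest[OF assms(1)])
    fix a assume "a \<in> A"
    then show "infdist x B - hausdorff_distance A B \<le> dist x a"
      using infdist_triangle[of x B a] infdist_le_hausdorff_distance[of a A B] assms by linarith
  qed
  then show ?thesis by linarith
qed

lemma norm_bodiesD:
  assumes "K \<in> norm_bodies"
  shows "K \<noteq> {}" "bounded K" "closed K"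
  using assms by (auto simp: norm_bodies_def convex_body_def compact_imp_bounded compact_imp_closed)

interpretation norm_space: Metric_space norm_bodies hausdorff_distance
proof
  fix A B C :: "'a set"
  show "0 \<le> hausdorff_distance A B" by (rule hausdorff_distance_nonneg)
  show "hausdorff_distance A B = hausdorff_distance B A" by (rule hausdorff_distance_commute)
  assume A: "A \<in> norm_bodies" and B: "B \<in> norm_bodies"
  note a = norm_bodiesD[OF A] and b = norm_bodiesD[OF B]
  show "hausdorff_distance A B = 0 \<longleftrightarrow> A = B"
  proof
    assume 0: "hausdorff_distance A B = 0"
    have "x \<in> B" if "x \<in> A" for x
      using infdist_le_hausdorff_distance[of x A B] that a b 0 infdist_nonneg[of x B]
        in_closed_iff_infdist_zero[of B x] by auto
    moreover have "x \<in> A" if "x \<in> B" for x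
      using infdist_le_hausdorff_distance[of x B A] that a b 0 infdist_nonneg[of x A]
        in_closed_iff_infdist_zero[of A x] by (auto simp: hausdorff_distance_commute)
    ultimately show "A = B" by blast
  next
    assume "A = B"
    then have "hausdorff_distance A B \<le> 0" using a by (intro hausdorff_distance_le) auto
    then show "hausdorff_distance A B = 0" using hausdorff_distance_nonneg[of A B] by linarith
  qed
  assume C: "C \<in> norm_bodies"
  note c = norm_bodiesD[OF C]
  show "hausdorff_distance A C \<le> hausdorff_distance A B + hausdorff_distance B C"
  proof (rule hausdorff_distance_le)
    fix x assume "x \<in> A"
    then show "infdist x C \<le> hausdorff_distance A B + hausdorff_distance B C"
      using infdist_le_infdist_hausdorff[of B C x] infdist_le_hausdorff_distance[of x A B] a b c
      by linarith
  next
    fix x assume "x \<in> C"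
    then show "infdist x A \<le> hausdorff_distance A B + hausdorff_distance B C"
      using infdist_le_infdist_hausdorff[of B A x] infdist_le_hausdorff_distance[of x C B] a b c
      by (simp add: hausdorff_distance_commute)
  qed (use a c in auto)
qed

definition borel_norm_bodies :: "'a::euclidean_space set measure" where
  "borel_norm_bodies = sigma norm_bodies {U. openin norm_space.mtopology U}"

definition supporting_hyperplane :: "'a::euclidean_space set \<Rightarrow> 'a set \<Rightarrow> bool" where
  "supporting_hyperplane K H \<longleftrightarrow>
    (\<exists>a b. a \<noteq> 0 \<and> H = {x. a \<bullet> x = b} \<and> K \<subseteq> {x. a \<bullet> x \<le> b} \<and> K \<inter> H \<noteq> {})"

definition smooth_body :: "'a::euclidean_space set \<Rightarrow> bool" where
  "smooth_body K \<longleftrightarrow>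
    convex_body K \<and> (\<forall>x\<in>frontier K. \<exists>!H. supporting_hyperplane K H \<and> x \<in> H)"

text \<open>The two hyperplanes are required to be distinct: a hyperplane is parallel to itself and
  would contribute distance \<open>0\<close>. For a convex body the infimum is attained.\<close>

definition width :: "'a::euclidean_space set \<Rightarrow> real" where
  "width K = Inf {setdist H H' | H H'. supporting_hyperplane K H \<and> supporting_hyperplane K H'
                                      \<and> affine_parallel H H' \<and> H \<noteq> H'}"

definition thinness :: "'a::euclidean_space set \<Rightarrow> real" where
  "thinness K = diameter K / (width K + diameter K)"

abbreviation std_normal_cdf :: "real \<Rightarrow> real" where
  "std_normal_cdf \<equiv> cdf std_normal_distribution"

text \<open>\<open>M\<close> is the normal distribution with mean \<open>1/2\<close> and variance \<open>(\<sigma>/2)\<^sup>2\<close> truncated to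
  \<open>[1/2, 1)\<close>, as a measure on that interval; the masses of the intervals \<open>[1/2, c]\<close> determine it.\<close>

definition is_truncated_normal :: "real \<Rightarrow> real measure \<Rightarrow> bool" where
  "is_truncated_normal \<sigma> M \<longleftrightarrow>
    prob_space M \<and> sets M = sets (restrict_space borel {1/2..<1}) \<and>
    (\<forall>c\<in>{1/2..<1}. measure M {1/2..c} =
      (std_normal_cdf ((2 * c - 1) / \<sigma>) - std_normal_cdf 0)
      / (std_normal_cdf (1 / \<sigma>) - std_normal_cdf 0))"

lemma measure_normal_interval:
  assumes "\<sigma> > 0" "a \<le> b"
    and A: "{a<..<b} \<subseteq> A" "A \<subseteq> {a..b}" "A \<in> sets borel"
  shows "measure (density lborel (normal_density (1/2) (\<sigma>/2))) A
    = std_normal_cdf ((2 * b - 1) / \<sigma>) - std_normal_cdf ((2 * a - 1) / \<sigma>)"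
proof -
  let ?S = std_normal_distribution
  let ?f = "\<lambda>x::real. 1/2 + \<sigma>/2 * x"
  interpret S: real_distribution ?S by (rule real_dist_normal_dist)
  have "distributed ?S lborel (\<lambda>x. x) std_normal_density"
    
    using distr_cong[of ?S ?S lborel ?S "\<lambda>x. x" "\<lambda>x. x"] distr_id2[of ?S ?S]
    by (simp add: distributed_def id_def)
  from S.normal_standard_normal_convert[THEN iffD2, of "\<sigma>/2" "?f" "1/2"]
  have "distributed ?S lborel ?f (normal_density (1/2) (\<sigma>/2))"
    using \<open>\<sigma> > 0\<close> \<open>distributed ?S lborel (\<lambda>x. x) std_normal_density\<close> by simp
  then have N: "density lborel (normal_density (1/2) (\<sigma>/2)) = distr ?S lborel ?f"
    by (simp add: distributed_def)
  define a' b' where ab: "a' = (2 * a - 1) / \<sigma>" "b' = (2 * b - 1) / \<sigma>"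
  have "a' \<le> b'" using assms by (simp add: ab divide_right_mono)
  have null: "measure ?S {x} = 0" for x :: real
  proof -
    have "emeasure ?S {x} = 0"
      by (subst emeasure_density) (auto simp: nn_integral_indicator_singleton)
    then show ?thesis by (simp add: measure_def)
  qed
  have "measure (density lborel (normal_density (1/2) (\<sigma>/2))) A = measure ?S (?f -` A)"
    unfolding N using A(3) by (subst measure_distr) auto
  also have "\<dots> = measure ?S {a'<..b'}"
  proof (rule S.finite_measure_eq_AE)
    have "AE x in ?S. x \<noteq> y" for y
      using AE_not_in[of "{y}" ?S] null[of y] by (auto simp: null_sets_def S.emeasure_eq_measure)
    from this[of a'] this[of b']
    show "AE x in ?S. x \<in> ?f -` A \<longleftrightarrow> x \<in> {a'<..b'}"
    proof eventually_elim
      case (elim x)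
      have 1: "?f x > a \<longleftrightarrow> x > a'" "?f x < b \<longleftrightarrow> x < b'" "?f x = a \<longleftrightarrow> x = a'" "?f x = b \<longleftrightarrow> x = b'"
        using \<open>\<sigma> > 0\<close> by (auto simp: ab field_simps)
      then show ?case using elim A(1,2) by (auto simp: subset_eq)
    qed
  qed (use A(3) measurable_sets_borel[of ?f borel A] in auto)
  also have "\<dots> = cdf ?S b' - cdf ?S a'"
    using \<open>a' \<le> b'\<close> S.cdf_diff_eq[of a' b'] by (cases "a' = b'") auto
  finally show ?thesis by (simp add: ab)
qed

text \<open>Conditioning the normal distribution on the interval has this distribution function.\<close>

lemma is_truncated_normal_conditioned:
  assumes "\<sigma> > 0"
  shows "is_truncated_normal \<sigma>
    (restrict_space (uniform_measure (density lborel (normal_density (1/2) (\<sigma>/2))) {1/2..<1}) {1/2..<1})"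
proof -
  let ?N = "density lborel (normal_density (1/2) (\<sigma>/2))"
  let ?I = "{1/2..<1::real}"
  let ?U = "uniform_measure ?N ?I"
  interpret N: prob_space ?N using assms by (intro prob_space_normal_density) auto
  have I: "measure ?N ?I = std_normal_cdf (1 / \<sigma>) - std_normal_cdf 0"
    using measure_normal_interval[OF assms, of "1/2" 1 ?I] by (simp add: subset_eq)
  have "emeasure ?N ?I \<noteq> 0"
  proof
    assume "emeasure ?N ?I = 0"
    then have "AE x in lborel. x \<notin> ?I"
      using assms by (auto simp: emeasure_density nn_integral_0_iff_AE indicator_def
        less_imp_neq[OF normal_density_pos, symmetric] elim!: eventually_mono split: if_splits)
    then have "emeasure lborel ?I = 0"
      by (subst (asm) AE_iff_measurable[of ?I]) auto
    then show False by simp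
  qed
  then interpret U: prob_space ?U by (intro prob_space_uniform_measure) auto
  have Um: "measure ?U A = measure ?N (?I \<inter> A) / measure ?N ?I" if "A \<in> sets borel" for A
    using that by (simp add: measure_uniform_measure \<open>emeasure ?N ?I \<noteq> 0\<close>)
  have "prob_space (restrict_space ?U ?I)"
    using Um[of ?I] \<open>emeasure ?N ?I \<noteq> 0\<close>
    by (intro prob_space_restrict_space)
      (auto simp: U.emeasure_eq_measure N.emeasure_eq_measure)
  moreover have "measure (restrict_space ?U ?I) {1/2..c}
      = (std_normal_cdf ((2 * c - 1) / \<sigma>) - std_normal_cdf 0)
        / (std_normal_cdf (1 / \<sigma>) - std_normal_cdf 0)" if "c \<in> ?I" for c
  proof -
    have "measure (restrict_space ?U ?I) {1/2..c} = measure ?N {1/2..c} / measure ?N ?I"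
      using that Um[of "{1/2..c}"]
      by (subst measure_restrict_space) (auto simp: Int_absorb1 subset_eq)
    then show ?thesis
      using measure_normal_interval[OF assms, of "1/2" c "{1/2..c}"] that
      by (simp add: I subset_eq)
  qed
  ultimately show ?thesis
    by (simp add: is_truncated_normal_def sets_restrict_space)
qed

end

theory Submission
  imports Defs
begin

text \<open>For a norm body \<open>K\<close> let \<open>R\<close> and \<open>r\<close> be the maximum and the minimum of its support function on
  the unit sphere, so that its thinness is \<open>R / (r + R)\<close>. If \<open>C\<close> is compact, convex and symmetric, the
  outer parallel body \<open>C + s B\<close> is smooth for \<open>s > 0\<close> and has radii \<open>R + s\<close> and \<open>r + s\<close>; hence, as \<open>s\<close>
  varies, its thinness sweeps out the interval between \<open>1/2\<close> and the thinness of \<open>C\<close> bijectively. Draw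
  \<open>C\<close> from a countable family of symmetric polytopes (with positive weights) and, independently, \<open>t\<close>
  from the truncated normal distribution, and take the parallel body of \<open>C\<close> with thinness \<open>t\<close> or, if
  there is none, a parallel body of a fixed segment. The law of this random body is \<open>P\<close>: its thinness
  is \<open>t\<close> by construction, and each open set contains a curve \<open>t \<mapsto> C + s(t) B\<close>, \<open>t\<close> in an open interval,
  because the bodies \<open>C + s B\<close> are dense.\<close>

section \<open>Support functions, width and thinness\<close>

lemma hausdorff_distance_attains:
  fixes K L :: "'a::euclidean_space set"
  assumes "x \<in> K" "compact K" "compact L" "L \<noteq> {}"
  obtains y where "y \<in> L" "dist x y \<le> hausdorff_distance K L"
proof -
  obtain y where "y \<in> L" "infdist x L = dist x y"
    using infdist_attains_inf[of L x] assms compact_imp_closed by blast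
  then show ?thesis
    using that infdist_le_hausdorff_distance[of x K L] assms by (metis compact_imp_bounded)
qed

lemma hausdorff_distance_leI:
  assumes "A \<noteq> {}" "B \<noteq> {}" "bounded A" "bounded B"
    and "\<And>a. a \<in> A \<Longrightarrow> \<exists>b\<in>B. dist a b \<le> r" "\<And>b. b \<in> B \<Longrightarrow> \<exists>a\<in>A. dist b a \<le> r"
  shows "hausdorff_distance A B \<le> r"
proof (rule hausdorff_distance_le[OF assms(1-4)])
  fix a assume "a \<in> A"
  then obtain b where "b \<in> B" "dist a b \<le> r" using assms(5) by blast
  then show "infdist a B \<le> r" by (rule infdist_le2)
next
  fix b assume "b \<in> B"
  then obtain a where "a \<in> A" "dist b a \<le> r" using assms(6) by blast
  then show "infdist b A \<le> r" by (rule infdist_le2)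
qed

section \<open>Support functions and the two radii\<close>

definition support_function :: "'a::euclidean_space set \<Rightarrow> 'a \<Rightarrow> real" where
  "support_function K u = (SUP x\<in>K. u \<bullet> x)"

text \<open>For nonempty compact \<open>K\<close> this is also the maximum of the support function
  on the unit sphere. For a centered set it is half the diameter.\<close>

definition outer_radius :: "'a::euclidean_space set \<Rightarrow> real" where
  "outer_radius K = (SUP x\<in>K. norm x)"

text \<open>For a norm body this is half the width, see \<open>width_norm_body\<close>.\<close>

definition inner_radius :: "'a::euclidean_space set \<Rightarrow> real" where
  "inner_radius K = (INF u\<in>sphere 0 1. support_function K u)"

lemma support_function_ge:
  assumes "compact K" "x \<in> K"
  shows "u \<bullet> x \<le> support_function K u"
proof -
  have "compact ((\<bullet>) u ` K)"
    using assms by (intro compact_continuous_image continuous_intros)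
  then show ?thesis
    unfolding support_function_def
    by (intro cSUP_upper assms bounded_imp_bdd_above compact_imp_bounded)
qed

lemma support_function_least:
  assumes "K \<noteq> {}" "\<And>x. x \<in> K \<Longrightarrow> u \<bullet> x \<le> c"
  shows "support_function K u \<le> c"
  using assms unfolding support_function_def by (intro cSUP_least)

lemma support_function_attains:
  assumes "compact K" "K \<noteq> {}"
  obtains x where "x \<in> K" "u \<bullet> x = support_function K u"
proof -
  have "continuous_on K ((\<bullet>) u)" by (intro continuous_intros)
  then obtain x where x: "x \<in> K" "\<And>y. y \<in> K \<Longrightarrow> u \<bullet> y \<le> u \<bullet> x"
    using continuous_attains_sup[OF assms, of "(\<bullet>) u"] by blast
  then have "u \<bullet> x = support_function K u"
    using support_function_least[OF assms(2), of u "u \<bullet> x"] support_function_ge[OF assms(1) x(1), of u]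
    by (intro antisym) auto
  with x(1) that show thesis by blast
qed

lemma outer_radius_ge:
  assumes "compact K" "x \<in> K"
  shows "norm x \<le> outer_radius K"
proof -
  have "compact (norm ` K)"
    using assms by (intro compact_continuous_image continuous_intros)
  then show ?thesis
    unfolding outer_radius_def
    by (intro cSUP_upper assms bounded_imp_bdd_above compact_imp_bounded)
qed

lemma outer_radius_least:
  assumes "K \<noteq> {}" "\<And>x. x \<in> K \<Longrightarrow> norm x \<le> c"
  shows "outer_radius K \<le> c"
  using assms unfolding outer_radius_def by (intro cSUP_least)

lemma outer_radius_attains:
  assumes "compact K" "K \<noteq> {}"
  obtains x where "x \<in> K" "norm x = outer_radius K"
proof -
  have "continuous_on K norm" by (intro continuous_intros)
  then obtain x where x: "x \<in> K" "\<And>y. y \<in> K \<Longrightarrow> norm y \<le> norm x"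
    using continuous_attains_sup[OF assms, of norm] by blast
  then have "norm x = outer_radius K"
    using outer_radius_least[OF assms(2), of "norm x"] outer_radius_ge[OF assms(1) x(1)]
    by (intro antisym) auto
  with x(1) that show thesis by blast
qed

lemma support_function_le_outer_radius:
  assumes "compact K" "K \<noteq> {}" "norm u = 1"
  shows "\<bar>support_function K u\<bar> \<le> outer_radius K"
proof -
  obtain x where x: "x \<in> K" "u \<bullet> x = support_function K u"
    using support_function_attains[OF assms(1,2)] .
  have "\<bar>u \<bullet> x\<bar> \<le> norm x" using Cauchy_Schwarz_ineq2[of u x] assms(3) by simp
  then show ?thesis using x outer_radius_ge[OF assms(1) x(1)] by linarith
qed

lemma sphere_nonempty: "sphere (0::'a::euclidean_space) 1 \<noteq> {}"
  by simp

lemma inner_radius_le: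
  assumes "compact K" "K \<noteq> {}" "norm u = 1"
  shows "inner_radius K \<le> support_function K u"
  unfolding inner_radius_def
proof (rule cINF_lower)
  show "bdd_below (support_function K ` sphere 0 1)"
    using support_function_le_outer_radius[OF assms(1,2)]
    by (intro bdd_belowI2[of _ "- outer_radius K"]) (smt (verit) mem_sphere_0)
qed (use assms in simp)

lemma inner_radius_greatest:
  assumes "\<And>u. norm u = 1 \<Longrightarrow> c \<le> support_function K u"
  shows "c \<le> inner_radius K"
  unfolding inner_radius_def using assms by (intro cINF_greatest sphere_nonempty) auto

lemma inner_radius_le_outer_radius:
  fixes K :: "'a::euclidean_space set"
  assumes "compact K" "K \<noteq> {}"
  shows "inner_radius K \<le> outer_radius K"
proof -
  obtain u :: 'a where u: "norm u = 1" using vector_choose_size[of 1] by auto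
  show ?thesis
    using inner_radius_le[OF assms u] support_function_le_outer_radius[OF assms u] by linarith
qed

text \<open>Each point of \<open>K\<close> has a point of \<open>L\<close> within the Hausdorff
  distance. The Lipschitz bounds for both radii yield measurability of the thinness and keep the
  radii apart under approximation.\<close>

lemma outer_radius_lipschitz:
  assumes "compact K" "K \<noteq> {}" "compact L" "L \<noteq> {}"
  shows "outer_radius K \<le> outer_radius L + hausdorff_distance K L"
proof (rule outer_radius_least)
  fix x assume "x \<in> K"
  then obtain y where "y \<in> L" "dist x y \<le> hausdorff_distance K L"
    using hausdorff_distance_attains[OF _ assms(1,3,4)] by metis
  then show "norm x \<le> outer_radius L + hausdorff_distance K L"
    using outer_radius_ge[OF assms(3)] norm_triangle_sub[of x y] by (fastforce simp: dist_norm)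
qed (use assms in auto)

lemma support_function_lipschitz:
  assumes "compact K" "K \<noteq> {}" "compact L" "L \<noteq> {}" "norm u = 1"
  shows "support_function K u \<le> support_function L u + hausdorff_distance K L"
proof (rule support_function_least)
  fix x assume "x \<in> K"
  then obtain y where y: "y \<in> L" "dist x y \<le> hausdorff_distance K L"
    using hausdorff_distance_attains[OF _ assms(1,3,4)] by metis
  have "u \<bullet> x - u \<bullet> y \<le> norm (x - y)"
    using norm_cauchy_schwarz[of u "x - y"] assms(5) by (simp add: inner_diff_right)
  then show "u \<bullet> x \<le> support_function L u + hausdorff_distance K L"
    using support_function_ge[OF assms(3) y(1), of u] y(2) by (simp add: dist_norm)
qed (use assms in auto)

text \<open>The support functions obey the same bound for every unit vector, so it passes to the
  infimum.\<close>

lemma inner_radius_lipschitz: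
  assumes "compact K" "K \<noteq> {}" "compact L" "L \<noteq> {}"
  shows "inner_radius K \<le> inner_radius L + hausdorff_distance K L"
proof -
  have "inner_radius K - hausdorff_distance K L \<le> inner_radius L"
  proof (rule inner_radius_greatest)
    fix u :: 'a assume u: "norm u = 1"
    show "inner_radius K - hausdorff_distance K L \<le> support_function L u"
      using inner_radius_le[OF assms(1,2) u] support_function_lipschitz[OF assms u] by linarith
  qed
  then show ?thesis by linarith
qed

definition centered_convex :: "'a::euclidean_space set \<Rightarrow> bool" where
  "centered_convex C \<longleftrightarrow> compact C \<and> convex C \<and> C \<noteq> {} \<and> uminus ` C = C"

lemma centered_convexD:
  assumes "centered_convex C"
  shows "compact C" "convex C" "C \<noteq> {}" "x \<in> C \<Longrightarrow> - x \<in> C" "0 \<in> C"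
proof -
  show *: "compact C" "convex C" "C \<noteq> {}" and "x \<in> C \<Longrightarrow> - x \<in> C" for x
    using assms by (auto simp: centered_convex_def)
  then obtain x where "x \<in> C" "- x \<in> C" by blast
  then show "0 \<in> C" using convexD[OF *(2), of x "-x" "1/2" "1/2"] by simp
qed

lemma uminus_image_eqI:
  fixes C :: "'a::group_add set"
  assumes "\<And>x. x \<in> C \<Longrightarrow> - x \<in> C"
  shows "uminus ` C = C"
proof (intro equalityI subsetI)
  fix x assume "x \<in> C"
  then show "x \<in> uminus ` C" using assms by (intro image_eqI[of _ _ "- x"]) auto
qed (use assms in auto)

lemma norm_bodies_iff: "K \<in> norm_bodies \<longleftrightarrow> centered_convex K \<and> interior K \<noteq> {}"
proof
  assume K: "K \<in> norm_bodies"
  then have "compact K" "convex K" "interior K \<noteq> {}" "uminus ` K = K"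
    unfolding norm_bodies_def convex_body_def by blast+
  then show "centered_convex K \<and> interior K \<noteq> {}"
    using norm_bodiesD(1)[OF K] unfolding centered_convex_def by blast
next
  assume "centered_convex K \<and> interior K \<noteq> {}"
  then show "K \<in> norm_bodies"
    unfolding norm_bodies_def convex_body_def centered_convex_def by blast
qed

lemma norm_bodies_centered: "K \<in> norm_bodies \<Longrightarrow> centered_convex K"
  by (simp add: norm_bodies_iff)

text \<open>The interior is convex and symmetric, so it contains the midpoint of one of its points
  and the negative of that point.\<close>

lemma norm_bodies_cball:
  assumes "K \<in> norm_bodies"
  obtains \<epsilon> where "\<epsilon> > 0" "cball 0 \<epsilon> \<subseteq> K"
proof -
  have K: "convex K" "uminus ` K = K" "interior K \<noteq> {}"
    using assms by (auto simp: norm_bodies_def convex_body_def)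
  then obtain x where x: "x \<in> interior K" by blast
  have "- x \<in> interior K"
    using x interior_negations[of K] K(2) by (metis image_eqI)
  then have "0 \<in> interior K"
    using x convexD[OF convex_interior[OF K(1)], of x "-x" "1/2" "1/2"] by simp
  then show thesis using that mem_interior_cball by metis
qed

lemma norm_bodiesI:
  assumes "centered_convex K" "cball 0 \<epsilon> \<subseteq> K" "\<epsilon> > 0"
  shows "K \<in> norm_bodies"
  using assms mem_interior_cball[of 0 K] by (auto simp: norm_bodies_iff)

lemma support_function_uminus:
  assumes "centered_convex C"
  shows "support_function C (- u) = support_function C u"
proof -
  have "(\<bullet>) (- u) ` C = (\<bullet>) u ` uminus ` C" by (simp add: image_image)
  then show ?thesis using assms by (simp add: support_function_def centered_convex_def)
qed

lemma inner_radius_pos: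
  assumes "K \<in> norm_bodies"
  shows "inner_radius K > 0"
proof -
  obtain \<epsilon> where \<epsilon>: "\<epsilon> > 0" "cball 0 \<epsilon> \<subseteq> K" using norm_bodies_cball[OF assms] .
  have "\<epsilon> \<le> inner_radius K"
  proof (rule inner_radius_greatest)
    fix u :: 'a assume u: "norm u = 1"
    then have "\<epsilon> *\<^sub>R u \<in> K" using \<epsilon> by auto
    from support_function_ge[OF _ this, of u] show "\<epsilon> \<le> support_function K u"
      using u assms norm_bodies_centered centered_convexD(1) by (auto simp: norm_eq_1)
  qed
  with \<epsilon> show ?thesis by linarith
qed

lemma support_function_pos:
  assumes "K \<in> norm_bodies" "norm u = 1"
  shows "support_function K u > 0"
  using inner_radius_pos[OF assms(1)] inner_radius_le[OF _ _ assms(2)]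
    centered_convexD(1,3)[OF norm_bodies_centered[OF assms(1)]]
  by (meson less_le_trans)

section \<open>Supporting hyperplanes, width, diameter and smoothness\<close>

lemma hyperplane_eq_imp_parallel:
  fixes a c :: "'a::euclidean_space"
  assumes "a \<noteq> 0" "c \<noteq> 0" and eq: "{x. a \<bullet> x = b} = {x. c \<bullet> x = d}"
  obtains k where "k \<noteq> 0" "c = k *\<^sub>R a"
proof -
  define k where "k = (a \<bullet> c) / (a \<bullet> a)"
  \<comment> \<open>The part of \<open>c\<close> orthogonal to \<open>a\<close>. Moving along it
    stays in the common hyperplane, so it is also orthogonal to \<open>c\<close>, hence to itself,
    and vanishes.\<close>
  define c' where "c' = c - k *\<^sub>R a"
  define y where "y = (b / (a \<bullet> a)) *\<^sub>R a"
  have ac': "a \<bullet> c' = 0" using assms(1) by (simp add: c'_def k_def inner_diff_right)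
  have y: "a \<bullet> y = b" using assms(1) by (simp add: y_def)
  then have "a \<bullet> (y + c') = b" using ac' by (simp add: inner_add_right)
  with y eq have "c \<bullet> y = d" "c \<bullet> (y + c') = d" by auto
  then have "c \<bullet> c' = 0" by (simp add: inner_add_right)
  then have "c' \<bullet> c' = 0" using ac' by (simp add: c'_def inner_diff_left inner_commute)
  then have "c = k *\<^sub>R a" by (simp add: c'_def)
  with that assms(2) show thesis by (cases "k = 0") auto
qed

text \<open>Normalizing the normal \<open>a\<close> turns the offset into \<open>b / norm a\<close>,
  which touching \<open>K\<close> forces to be the support value.\<close>

lemma supporting_hyperplaneE:
  fixes K :: "'a::euclidean_space set"
  assumes "supporting_hyperplane K H" "compact K"
  obtains u where "norm u = 1" "H = {x. u \<bullet> x = support_function K u}"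
proof -
  from assms(1) obtain a b y where a: "a \<noteq> 0" "H = {x. a \<bullet> x = b}" "\<And>x. x \<in> K \<Longrightarrow> a \<bullet> x \<le> b"
    "y \<in> K" "a \<bullet> y = b"
    unfolding supporting_hyperplane_def by blast
  define u where "u = a /\<^sub>R norm a"
  have "support_function K u = b / norm a"
  proof (rule antisym)
    show "support_function K u \<le> b / norm a"
      using a by (intro support_function_least) (auto simp: u_def field_simps)
    show "b / norm a \<le> support_function K u"
      using support_function_ge[OF assms(2) a(4), of u] a(5) by (simp add: u_def field_simps)
  qed
  then have "H = {x. u \<bullet> x = support_function K u}" using a(1,2) by (auto simp: u_def field_simps)
  moreover have "norm u = 1" using a(1) by (simp add: u_def)
  ultimately show thesis using that by blast
qed

lemma supporting_hyperplaneI: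
  fixes K :: "'a::euclidean_space set"
  assumes "compact K" "K \<noteq> {}" "norm u = 1"
  shows "supporting_hyperplane K {x. u \<bullet> x = support_function K u}"
proof -
  obtain x where "x \<in> K" "u \<bullet> x = support_function K u"
    using support_function_attains[OF assms(1,2)] .
  then show ?thesis using assms support_function_ge[OF assms(1)]
    unfolding supporting_hyperplane_def by (intro exI[of _ u] exI conjI) auto
qed

lemma setdist_parallel_hyperplanes:
  fixes u :: "'a::euclidean_space"
  assumes "norm u = 1" "b \<ge> 0"
  shows "setdist {x. u \<bullet> x = b} {x. u \<bullet> x = - b} = 2 * b"
proof (rule antisym)
  have uu: "u \<bullet> u = 1" using assms by (simp add: norm_eq_1)
  have "setdist {x. u \<bullet> x = b} {x. u \<bullet> x = - b} \<le> dist (b *\<^sub>R u) ((- b) *\<^sub>R u)"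
    by (rule setdist_le_dist) (auto simp: uu)
  also have "\<dots> = 2 * b" using assms by (simp add: dist_norm flip: scaleR_add_left)
  finally show "setdist {x. u \<bullet> x = b} {x. u \<bullet> x = - b} \<le> 2 * b" .
  show "2 * b \<le> setdist {x. u \<bullet> x = b} {x. u \<bullet> x = - b}"
  proof (rule le_setdistI)
    show "{x. u \<bullet> x = b} \<noteq> {}" "{x. u \<bullet> x = - b} \<noteq> {}"
    proof -
      have "b *\<^sub>R u \<in> {x. u \<bullet> x = b}" "(- b) *\<^sub>R u \<in> {x. u \<bullet> x = - b}" by (simp_all add: uu)
      then show "{x. u \<bullet> x = b} \<noteq> {}" "{x. u \<bullet> x = - b} \<noteq> {}" by blast+
    qed
    fix x y assume "x \<in> {x. u \<bullet> x = b}" "y \<in> {x. u \<bullet> x = - b}"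
    then show "2 * b \<le> dist x y"
      using norm_cauchy_schwarz[of u "x - y"] assms by (simp add: dist_norm inner_diff_right)
  qed
qed

text \<open>By symmetry the supporting hyperplane parallel to the one with normal \<open>u\<close>
  has normal \<open>- u\<close> and the opposite offset. The pairs thus contribute exactly the
  distances \<open>2 * support_function K u\<close>.\<close>

lemma width_norm_body:
  fixes K :: "'a::euclidean_space set"
  assumes "K \<in> norm_bodies"
  shows "width K = 2 * inner_radius K"
proof -
  note cK = norm_bodies_centered[OF assms]
  note K = centered_convexD[OF cK]
  have "{setdist H H' | H H'. supporting_hyperplane K H \<and> supporting_hyperplane K H'
                                      \<and> affine_parallel H H' \<and> H \<noteq> H'}
    = (\<lambda>u. 2 * support_function K u) ` sphere 0 1" (is "?A = ?B")
  proof (intro equalityI subsetI)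
    fix w assume "w \<in> ?A"
    then obtain H H' where H: "supporting_hyperplane K H" "supporting_hyperplane K H'"
        "affine_parallel H H'" "H \<noteq> H'" "w = setdist H H'" by blast
    obtain u where u: "norm u = 1" "H = {x. u \<bullet> x = support_function K u}"
      using supporting_hyperplaneE[OF H(1) K(1)] .
    obtain v where v: "norm v = 1" "H' = {x. v \<bullet> x = support_function K v}"
      using supporting_hyperplaneE[OF H(2) K(1)] .
    obtain a where a: "H' = (\<lambda>x. a + x) ` H" using H(3) unfolding affine_parallel_def by blast
    have "H' = {x. u \<bullet> x = support_function K u + u \<bullet> a}"
    proof (intro equalityI subsetI)
      fix x assume "x \<in> {x. u \<bullet> x = support_function K u + u \<bullet> a}"
      then have "x - a \<in> H" by (simp add: u inner_diff_right)
      then show "x \<in> H'" unfolding a by (intro image_eqI[of _ _ "x - a"]) auto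
    qed (auto simp: a u inner_add_right)
    with v have "{x. u \<bullet> x = support_function K u + u \<bullet> a} = {x. v \<bullet> x = support_function K v}" by simp
    moreover have "u \<noteq> 0" "v \<noteq> 0" using u v by auto
    ultimately obtain k where k: "v = k *\<^sub>R u" using hyperplane_eq_imp_parallel by metis
    \<comment> \<open>Both normals are unit vectors, and \<open>k = 1\<close> would give
      \<open>H' = H\<close>. The distinctness required in \<open>width\<close> leaves the opposite
      normal.\<close>
    then have "k = 1 \<or> k = -1" using u v by auto
    then have "v = - u" using k H(4) u v by auto
    then have "H' = {x. u \<bullet> x = - support_function K u}"
      using v support_function_uminus[OF cK, of u] by auto
    then have "w = 2 * support_function K u"
      using H(5) u setdist_parallel_hyperplanes[OF u(1)] support_function_pos[OF assms u(1)]
      by simp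
    then show "w \<in> ?B" using u(1) by auto
  next
    fix w assume "w \<in> ?B"
    then obtain u where u: "norm u = 1" "w = 2 * support_function K u" by auto
    define H where "H = {x. u \<bullet> x = support_function K u}"
    define H' where "H' = {x. (- u) \<bullet> x = support_function K (- u)}"
    have uu: "u \<bullet> u = 1" using u by (simp add: norm_eq_1)
    have pos: "support_function K u > 0" by (rule support_function_pos[OF assms u(1)])
    have H': "H' = {x. u \<bullet> x = - support_function K u}"
      unfolding H'_def support_function_uminus[OF cK] by auto
    have "supporting_hyperplane K H" "supporting_hyperplane K H'"
      using supporting_hyperplaneI[OF K(1,3), of u] supporting_hyperplaneI[OF K(1,3), of "- u"] u(1)
      unfolding H_def H'_def by simp_all
    moreover have "H' = (\<lambda>x. - (2 * support_function K u) *\<^sub>R u + x) ` H"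
    proof (intro equalityI subsetI)
      fix x assume "x \<in> H'"
      then show "x \<in> (\<lambda>x. - (2 * support_function K u) *\<^sub>R u + x) ` H"
        by (intro image_eqI[of _ _ "x + (2 * support_function K u) *\<^sub>R u"])
          (simp_all add: H' H_def inner_add_right uu)
    next
      fix x assume "x \<in> (\<lambda>x. - (2 * support_function K u) *\<^sub>R u + x) ` H"
      then obtain y where "y \<in> H" "x = - (2 * support_function K u) *\<^sub>R u + y" by blast
      then show "x \<in> H'" by (simp add: H' H_def inner_add_right inner_diff_right uu)
    qed
    then have "affine_parallel H H'" unfolding affine_parallel_def by blast
    moreover have "H \<noteq> H'"
    proof -
      have "support_function K u *\<^sub>R u \<in> H" "support_function K u *\<^sub>R u \<notin> H'"
        using pos by (auto simp: H' H_def uu)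
      then show ?thesis by blast
    qed
    moreover have "w = setdist H H'"
      using setdist_parallel_hyperplanes[OF u(1)] pos u(2) unfolding H_def H' by simp
    ultimately show "w \<in> ?A" by blast
  qed
  then have "width K = (INF u\<in>sphere 0 1. 2 * support_function K u)" by (simp add: width_def)
  also have "\<dots> = 2 * inner_radius K"
  proof (rule cInf_eq_non_empty)
    fix x assume "x \<in> (\<lambda>u. 2 * support_function K u) ` sphere 0 1"
    then show "2 * inner_radius K \<le> x" using inner_radius_le[OF K(1,3)] by auto
  next
    fix y assume y: "\<And>x. x \<in> (\<lambda>u. 2 * support_function K u) ` sphere 0 1 \<Longrightarrow> y \<le> x"
    have "y / 2 \<le> inner_radius K"
    proof (rule inner_radius_greatest)
      fix u :: 'a assume "norm u = 1"
      then show "y / 2 \<le> support_function K u" using y[of "2 * support_function K u"] by auto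
    qed
    then show "y \<le> 2 * inner_radius K" by simp
  qed simp
  finally show ?thesis .
qed

text \<open>The upper bound is the triangle inequality through the origin; a farthest point
  \<open>x\<close> and its antipode \<open>- x\<close> attain it.\<close>

lemma diameter_centered:
  assumes "centered_convex K"
  shows "diameter K = 2 * outer_radius K"
proof (rule antisym)
  note K = centered_convexD[OF assms]
  have "dist x y \<le> 2 * outer_radius K" if "x \<in> K" "y \<in> K" for x y
    using outer_radius_ge[OF K(1) that(1)] outer_radius_ge[OF K(1) that(2)] norm_triangle_ineq4[of x y]
    by (simp add: dist_norm)
  then show "diameter K \<le> 2 * outer_radius K"
    using K(3) by (intro diameter_le) (auto simp: dist_norm)
  obtain x where x: "x \<in> K" "norm x = outer_radius K" using outer_radius_attains[OF K(1,3)] .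
  have "dist x (- x) \<le> diameter K"
    using K(4)[OF x(1)] x(1) compact_imp_bounded[OF K(1)] by (intro diameter_bounded_bound)
  moreover have "dist x (- x) = 2 * norm x"
    by (simp add: dist_norm flip: scaleR_2)
  ultimately show "2 * outer_radius K \<le> diameter K" using x(2) by simp
qed

lemma thinness_norm_body:
  assumes "K \<in> norm_bodies"
  shows "thinness K = outer_radius K / (inner_radius K + outer_radius K)"
  unfolding thinness_def width_norm_body[OF assms] diameter_centered[OF norm_bodies_centered[OF assms]]
    distrib_left[symmetric] by (rule mult_divide_mult_cancel_left) simp

lemma norm_bodies_radii:
  assumes "K \<in> norm_bodies"
  shows "0 < inner_radius K" "inner_radius K \<le> outer_radius K"
  by (intro inner_radius_pos inner_radius_le_outer_radius assms
    centered_convexD(1,3)[OF norm_bodies_centered[OF assms]])+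

lemma thinness_range:
  assumes "K \<in> norm_bodies"
  shows "thinness K \<in> {1/2..<1}"
  using norm_bodies_radii[OF assms] by (auto simp: thinness_norm_body[OF assms] field_simps)

text \<open>Supporting hyperplanes at \<open>x\<close> correspond to unit outer normals at
  \<open>x\<close>, and a point where a support value is attained is automatically a frontier point.
  This form, free of hyperplanes and frontiers, is convenient for limits.\<close>

lemma smooth_body_iff:
  fixes K :: "'a::euclidean_space set"
  assumes "K \<in> norm_bodies"
  shows "smooth_body K \<longleftrightarrow>
    (\<forall>x\<in>K. \<forall>u v. norm u = 1 \<longrightarrow> norm v = 1 \<longrightarrow>
       u \<bullet> x = support_function K u \<longrightarrow> v \<bullet> x = support_function K v \<longrightarrow> u = v)"
proof -
  note K = centered_convexD[OF norm_bodies_centered[OF assms]]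
  have body: "convex_body K" using assms by (simp add: norm_bodies_def)
  have "u = v" if smooth: "smooth_body K" and x: "x \<in> K" and u: "norm u = 1" "u \<bullet> x = support_function K u"
    and v: "norm v = 1" "v \<bullet> x = support_function K v" for x u v
  proof -
    \<comment> \<open>A small step from \<open>x\<close> in the direction \<open>u\<close> would
      exceed the support value.\<close>
    have "x \<notin> interior K"
    proof
      assume "x \<in> interior K"
      then obtain \<epsilon> where \<epsilon>: "\<epsilon> > 0" "cball x \<epsilon> \<subseteq> K" by (auto simp: mem_interior_cball)
      then have "x + \<epsilon> *\<^sub>R u \<in> K" using u by (auto simp: dist_norm)
      from support_function_ge[OF K(1) this, of u] show False
        using u \<epsilon> by (simp add: inner_add_right norm_eq_1)
    qed
    then have "x \<in> frontier K" using x closure_subset by (auto simp: frontier_def)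
    then have "\<exists>!H. supporting_hyperplane K H \<and> x \<in> H" using smooth by (auto simp: smooth_body_def)
    then have eq: "{x. u \<bullet> x = support_function K u} = {x. v \<bullet> x = support_function K v}"
      using supporting_hyperplaneI[OF K(1,3) u(1)] supporting_hyperplaneI[OF K(1,3) v(1)] u v by blast
    have "u \<noteq> 0" "v \<noteq> 0" using u v by auto
    then obtain k where k: "v = k *\<^sub>R u" using hyperplane_eq_imp_parallel[OF _ _ eq] by metis
    then have "k = 1 \<or> k = -1" using u v by auto
    \<comment> \<open>Opposite normals at one point would make both \<open>u \<bullet> x\<close> and
      its negative positive support values.\<close>
    moreover have "k \<noteq> -1"
      using k u(2) v(2) support_function_pos[OF assms u(1)] support_function_pos[OF assms v(1)] by auto
    ultimately show "u = v" using k by simp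
  qed
  moreover have "smooth_body K"
    if *: "\<And>x u v. x \<in> K \<Longrightarrow> norm u = 1 \<Longrightarrow> norm v = 1 \<Longrightarrow> u \<bullet> x = support_function K u
      \<Longrightarrow> v \<bullet> x = support_function K v \<Longrightarrow> u = v"
    unfolding smooth_body_def
  proof (intro conjI body ballI ex_ex1I)
    fix x assume x: "x \<in> frontier K"
    then have xK: "x \<in> K" using compact_imp_closed[OF K(1)] by (auto simp: frontier_def)
    \<comment> \<open>As \<open>K\<close> has interior points, its relative interior is its
      interior, so the supporting hyperplane theorem for relative boundary points applies.\<close>
    have "x \<notin> rel_interior K"
      using x assms rel_interior_nonempty_interior[of K] by (auto simp: frontier_def norm_bodies_iff)
    then obtain a where a: "a \<noteq> 0" "\<And>y. y \<in> K \<Longrightarrow> a \<bullet> x \<le> a \<bullet> y"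
      using supporting_hyperplane_rel_boundary[OF K(2) xK] by metis
    then show "\<exists>H. supporting_hyperplane K H \<and> x \<in> H"
      using xK unfolding supporting_hyperplane_def
      by (intro exI[of _ "{y. (- a) \<bullet> y = (- a) \<bullet> x}"] conjI exI[of _ "-a"] exI[of _ "(-a) \<bullet> x"]) auto
  next
    fix x H H' assume x: "x \<in> frontier K"
      and H: "supporting_hyperplane K H \<and> x \<in> H" and H': "supporting_hyperplane K H' \<and> x \<in> H'"
    then have xK: "x \<in> K" using compact_imp_closed[OF K(1)] by (auto simp: frontier_def)
    obtain u where u: "norm u = 1" "H = {x. u \<bullet> x = support_function K u}"
      using supporting_hyperplaneE[of K H] K(1) H by blast
    obtain v where v: "norm v = 1" "H' = {x. v \<bullet> x = support_function K v}"
      using supporting_hyperplaneE[of K H'] K(1) H' by blast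
    have "u = v" using *[OF xK u(1) v(1)] u v H H' by blast
    then show "H = H'" using u v by simp
  qed
  ultimately show ?thesis by blast
qed

section \<open>Parallel bodies\<close>

lemma centered_convex_plus:
  fixes C D :: "'a::euclidean_space set"
  assumes "centered_convex C" "centered_convex D"
  shows "centered_convex (C + D)"
  unfolding centered_convex_def
proof (intro conjI)
  note C = centered_convexD[OF assms(1)] and D = centered_convexD[OF assms(2)]
  have "C + D = {x + y | x y. x \<in> C \<and> y \<in> D}" by (auto simp: set_plus_def)
  then show "compact (C + D)" using compact_sums[OF C(1) D(1)] by simp
  show "convex (C + D)" by (rule convex_set_plus[OF C(2) D(2)])
  show "C + D \<noteq> {}" using C(3) D(3) by (auto simp: set_plus_def)
  show "uminus ` (C + D) = C + D"
  proof (rule uminus_image_eqI)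
    fix x assume "x \<in> C + D"
    then obtain c d where "c \<in> C" "d \<in> D" "x = c + d" by (auto elim: set_plus_elim)
    then show "- x \<in> C + D" using set_plus_intro[OF C(4) D(4), of c d] by simp
  qed
qed

lemma support_function_plus:
  assumes "centered_convex C" "centered_convex D"
  shows "support_function (C + D) u = support_function C u + support_function D u"
proof (rule antisym)
  note C = centered_convexD[OF assms(1)] and D = centered_convexD[OF assms(2)]
  note CD = centered_convexD[OF centered_convex_plus[OF assms]]
  show "support_function (C + D) u \<le> support_function C u + support_function D u"
  proof (rule support_function_least[OF CD(3)])
    fix x assume "x \<in> C + D"
    then obtain c d where "c \<in> C" "d \<in> D" "x = c + d" by (auto elim: set_plus_elim)
    then show "u \<bullet> x \<le> support_function C u + support_function D u"
      using support_function_ge[OF C(1), of c u] support_function_ge[OF D(1), of d u]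
      by (simp add: inner_add_right)
  qed
  obtain c d where cd: "c \<in> C" "u \<bullet> c = support_function C u" "d \<in> D" "u \<bullet> d = support_function D u"
    using support_function_attains[OF C(1,3)] support_function_attains[OF D(1,3)] by metis
  then show "support_function C u + support_function D u \<le> support_function (C + D) u"
    using support_function_ge[OF CD(1) set_plus_intro[of c C d D], of u] by (simp add: inner_add_right)
qed

text \<open>Since the origin lies in \<open>C\<close>, the sum contains \<open>D\<close> and with it
  a ball about the origin; \<open>C\<close> itself may be flat.\<close>

lemma norm_bodies_plus:
  assumes "centered_convex C" "D \<in> norm_bodies"
  shows "C + D \<in> norm_bodies"
proof -
  obtain \<epsilon> where \<epsilon>: "\<epsilon> > 0" "cball 0 \<epsilon> \<subseteq> D" using norm_bodies_cball[OF assms(2)] .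
  moreover have "D \<subseteq> C + D"
    using set_plus_intro[OF centered_convexD(5)[OF assms(1)]] by fastforce
  ultimately show ?thesis
    by (intro norm_bodiesI[OF centered_convex_plus[OF assms(1) norm_bodies_centered[OF assms(2)]]]) auto
qed

lemma norm_bodies_cball_0:
  assumes "s > 0"
  shows "cball (0::'a::euclidean_space) s \<in> norm_bodies"
proof (rule norm_bodiesI)
  show "centered_convex (cball (0::'a) s)"
    unfolding centered_convex_def using assms by (auto intro!: uminus_image_eqI)
qed (use assms in auto)

lemma support_function_cball_0:
  fixes u :: "'a::euclidean_space"
  assumes "norm u = 1" "s \<ge> 0"
  shows "support_function (cball 0 s) u = s"
proof (rule antisym)
  show "support_function (cball 0 s) u \<le> s"
  proof (rule support_function_least)
    fix x :: 'a assume "x \<in> cball 0 s"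
    then show "u \<bullet> x \<le> s" using norm_cauchy_schwarz[of u x] assms by simp
  qed (use assms in auto)
  have "s *\<^sub>R u \<in> cball 0 s" using assms by simp
  from support_function_ge[OF compact_cball this, of u]
  show "s \<le> support_function (cball 0 s) u" using assms by (simp add: norm_eq_1)
qed

text \<open>Adding the ball raises the support function by the constant \<open>s\<close> on the unit
  sphere.\<close>

lemma inner_radius_parallel:
  fixes C :: "'a::euclidean_space set"
  assumes "centered_convex C" "s > 0"
  shows "inner_radius (C + cball 0 s) = inner_radius C + s"
proof (rule antisym)
  note C = centered_convexD[OF assms(1)]
  have B: "centered_convex (cball (0::'a) s)"
    using norm_bodies_cball_0[OF assms(2)] by (rule norm_bodies_centered)
  note CB = centered_convexD[OF centered_convex_plus[OF assms(1) B]]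
  have h: "support_function (C + cball 0 s) u = support_function C u + s" if "norm u = 1" for u
    using support_function_plus[OF assms(1) B] support_function_cball_0[OF that] assms(2) by simp
  show "inner_radius C + s \<le> inner_radius (C + cball 0 s)"
    using h inner_radius_le[OF C(1,3)] by (intro inner_radius_greatest) auto
  have "inner_radius (C + cball 0 s) - s \<le> inner_radius C"
    using h inner_radius_le[OF CB(1,3)] by (intro inner_radius_greatest) fastforce
  then show "inner_radius (C + cball 0 s) \<le> inner_radius C + s" by simp
qed

lemma outer_radius_plus_le:
  assumes "centered_convex C" "centered_convex D"
  shows "outer_radius (C + D) \<le> outer_radius C + outer_radius D"
proof (rule outer_radius_least)
  note C = centered_convexD[OF assms(1)] and D = centered_convexD[OF assms(2)]
  show "C + D \<noteq> {}" using centered_convexD(3)[OF centered_convex_plus[OF assms]] .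
  fix x assume "x \<in> C + D"
  then obtain c d where "c \<in> C" "d \<in> D" "x = c + d" by (auto elim: set_plus_elim)
  then show "norm x \<le> outer_radius C + outer_radius D"
    using outer_radius_ge[OF C(1), of c] outer_radius_ge[OF D(1), of d] norm_triangle_ineq[of c d] by simp
qed

lemma outer_radius_cball_0:
  assumes "s \<ge> 0"
  shows "outer_radius (cball (0::'a::euclidean_space) s) \<le> s"
  using assms by (intro outer_radius_least) auto

text \<open>A point of \<open>C\<close> of largest norm can be pushed outward by \<open>s\<close>
  along its own direction; if that point is the origin, any direction serves.\<close>

lemma outer_radius_parallel:
  fixes C :: "'a::euclidean_space set"
  assumes "centered_convex C" "s > 0"
  shows "outer_radius (C + cball 0 s) = outer_radius C + s"
proof (rule antisym)
  note C = centered_convexD[OF assms(1)]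
  have B: "centered_convex (cball (0::'a) s)"
    using norm_bodies_cball_0[OF assms(2)] by (rule norm_bodies_centered)
  note CB = centered_convexD[OF centered_convex_plus[OF assms(1) B]]
  show "outer_radius (C + cball 0 s) \<le> outer_radius C + s"
    using outer_radius_plus_le[OF assms(1) B] outer_radius_cball_0[of s, where 'a='a] assms(2) by simp
  obtain x where x: "x \<in> C" "norm x = outer_radius C" using outer_radius_attains[OF C(1,3)] .
  obtain u where u: "norm u = 1" "x = norm x *\<^sub>R u"
  proof (cases "x = 0")
    case True
    obtain u :: 'a where "norm u = 1" using vector_choose_size[of 1] by auto
    with True that show thesis by simp
  next
    case False
    with that[of "sgn x"] show thesis by (simp add: norm_sgn sgn_div_norm)
  qed
  have "x + s *\<^sub>R u \<in> C + cball 0 s" using x u assms(2) by (intro set_plus_intro) auto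
  then have "norm (x + s *\<^sub>R u) \<le> outer_radius (C + cball 0 s)" by (rule outer_radius_ge[OF CB(1)])
  moreover have "x + s *\<^sub>R u = (norm x + s) *\<^sub>R u" using u(2) by (metis scaleR_add_left)
  then have "norm (x + s *\<^sub>R u) = norm x + s" using u(1) assms(2) by simp
  ultimately show "outer_radius C + s \<le> outer_radius (C + cball 0 s)" using x(2) by simp
qed

lemma hausdorff_distance_plus:
  assumes "centered_convex C" "centered_convex D"
  shows "hausdorff_distance (C + D) C \<le> outer_radius D"
proof (rule hausdorff_distance_leI)
  note C = centered_convexD[OF assms(1)] and D = centered_convexD[OF assms(2)]
  note CD = centered_convexD[OF centered_convex_plus[OF assms]]
  show "C + D \<noteq> {}" "C \<noteq> {}" "bounded (C + D)" "bounded C"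
    using C CD by (auto intro: compact_imp_bounded)
  fix x
  show "\<exists>b\<in>C. dist x b \<le> outer_radius D" if x: "x \<in> C + D"
  proof -
    obtain c d where cd: "c \<in> C" "d \<in> D" "x = c + d" using x by (auto elim: set_plus_elim)
    then have "dist x c \<le> outer_radius D" using outer_radius_ge[OF D(1), of d] by (simp add: dist_norm)
    with cd(1) show ?thesis by blast
  qed
  show "\<exists>a\<in>C + D. dist x a \<le> outer_radius D" if "x \<in> C"
    using set_plus_intro[OF that D(5)] outer_radius_ge[OF D(1) D(5)] by (intro bexI[of _ x]) simp_all
qed

lemma hausdorff_distance_parallel:
  fixes C :: "'a::euclidean_space set"
  assumes C: "centered_convex C" and "s > 0" "t > 0"
  shows "hausdorff_distance (C + cball 0 s) (C + cball 0 t) \<le> \<bar>s - t\<bar>"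
proof -
  have *: "\<exists>y \<in> C + cball 0 t. dist x y \<le> \<bar>s - t\<bar>" if "x \<in> C + cball 0 s" "s > 0" "t > 0" for x s t
  proof -
    obtain c z where cz: "c \<in> C" "z \<in> cball 0 s" "x = c + z" using \<open>x \<in> _\<close> by (auto elim: set_plus_elim)
    show ?thesis
    proof (cases "s \<le> t")
      case True
      with cz have "x \<in> C + cball 0 t" by (auto intro!: set_plus_intro)
      then show ?thesis by (intro bexI[of _ x]) auto
    next
      case False
      \<comment> \<open>The larger ball is rescaled onto the smaller one: replacing \<open>z\<close>
        by \<open>(t / s) *\<^sub>R z\<close> moves the point by at most
        \<open>s - t\<close>.\<close>
      have z: "norm z / s \<le> 1" using cz that by (simp add: field_simps)
      have "norm ((t / s) *\<^sub>R z) = t * (norm z / s)" using that by simp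
      also have "\<dots> \<le> t * 1" using that by (intro mult_left_mono z) auto
      finally have "c + (t / s) *\<^sub>R z \<in> C + cball 0 t" using cz by (intro set_plus_intro) auto
      moreover have "dist x (c + (t / s) *\<^sub>R z) \<le> \<bar>s - t\<bar>"
      proof -
        have "dist x (c + (t / s) *\<^sub>R z) = norm ((1 - t / s) *\<^sub>R z)"
          by (simp add: cz dist_norm scaleR_diff_left)
        also have "\<dots> = (s - t) * (norm z / s)" using that False by (simp add: field_simps)
        also have "\<dots> \<le> (s - t) * 1" using False by (intro mult_left_mono z) auto
        finally show ?thesis using False by simp
      qed
      ultimately show ?thesis by blast
    qed
  qed
  have "compact (C + cball 0 s) \<and> C + cball 0 s \<noteq> {}" if "s > 0" for s
    using centered_convexD(1,3)[OF centered_convex_plus[OF C norm_bodies_centered[OF norm_bodies_cball_0[OF that]]]]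
    by blast
  with assms(2,3) show ?thesis
    using *[of _ s t] *[of _ t s] by (intro hausdorff_distance_leI) (auto simp: compact_imp_bounded abs_minus_commute)
qed

lemma norm_bodies_parallel:
  assumes "centered_convex C" "s > 0"
  shows "C + cball 0 s \<in> norm_bodies"
  by (rule norm_bodies_plus[OF assms(1) norm_bodies_cball_0[OF assms(2)]])

text \<open>Every boundary point lies on a ball of radius \<open>s\<close> contained in the body, and the ball leaves only
  one choice for the outer normal.\<close>

lemma smooth_body_parallel:
  fixes C :: "'a::euclidean_space set"
  assumes C: "centered_convex C" and s: "s > 0"
  shows "smooth_body (C + cball 0 s)"
  unfolding smooth_body_iff[OF norm_bodies_parallel[OF assms]]
proof (intro ballI allI impI)
  fix x u v
  assume "x \<in> C + cball 0 s" and u: "norm u = 1" "u \<bullet> x = support_function (C + cball 0 s) u"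
    and v: "norm v = 1" "v \<bullet> x = support_function (C + cball 0 s) v"
  then obtain c y where cy: "c \<in> C" "norm y \<le> s" "x = c + y" by (auto elim: set_plus_elim)
  \<comment> \<open>A unit normal \<open>w\<close> at \<open>x\<close> satisfies
    \<open>w \<bullet> y \<ge> s\<close>, while \<open>norm y \<le> s\<close>. This is the equality
    case of Cauchy-Schwarz, so \<open>y\<close> determines \<open>w\<close>.\<close>
  have y: "y = s *\<^sub>R w" if w: "norm w = 1" "w \<bullet> x = support_function (C + cball 0 s) w" for w
  proof -
    have "support_function (C + cball 0 s) w = support_function C w + s"
      using support_function_plus[OF C norm_bodies_centered[OF norm_bodies_cball_0[OF s]], of w]
        support_function_cball_0[OF w(1), of s] s by simp
    then have "s \<le> w \<bullet> y"
      using w(2) support_function_ge[OF centered_convexD(1)[OF C] cy(1), of w] cy(3)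
      by (simp add: inner_add_right)
    then have "s * s \<le> s * (w \<bullet> y)" using s by (intro mult_left_mono) auto
    moreover have "y \<bullet> y \<le> s * s"
      using cy(2) by (metis norm_ge_zero power2_eq_square power2_norm_eq_inner power_mono)
    moreover have "(y - s *\<^sub>R w) \<bullet> (y - s *\<^sub>R w) = y \<bullet> y - 2 * (s * (w \<bullet> y)) + s * s"
      using w(1) by (simp add: inner_diff_left inner_diff_right inner_commute norm_eq_1 algebra_simps)
    ultimately have "(y - s *\<^sub>R w) \<bullet> (y - s *\<^sub>R w) \<le> 0" by linarith
    then show ?thesis by (metis eq_iff_diff_eq_0 inner_eq_zero_iff inner_ge_zero order_antisym)
  qed
  from y[OF u] y[OF v] s show "u = v" by simp
qed

text \<open>From dimension two on the sphere is connected. A finite connected set is a single point,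
  but the sphere contains \<open>u\<close> and \<open>- u\<close>.\<close>

lemma infinite_sphere:
  assumes "DIM('a::euclidean_space) \<ge> 2"
  shows "infinite (sphere (0::'a) 1)"
proof
  assume fin: "finite (sphere (0::'a) 1)"
  obtain u :: 'a where u: "norm u = 1" using vector_choose_size[of 1] by auto
  have "connected (sphere (0::'a) 1)" using assms by (intro connected_sphere)
  then obtain w where "sphere (0::'a) 1 = {w}"
    using fin connected_finite_iff_sing[of "sphere (0::'a) 1"] by auto
  with u have "u = w" "- u = w" by (metis mem_sphere_0 norm_minus_cancel singletonD)+
  then have "u + u = 0" by (metis add.right_inverse)
  then have "2 *\<^sub>R u = 0" by (simp add: scaleR_2)
  with u show False by simp
qed

text \<open>Some vertex of a polytope has infinitely many outer unit normals, as each of the infinitely many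
  unit vectors is an outer normal at one of the finitely many vertices.\<close>

lemma polytope_not_smooth:
  fixes K :: "'a::euclidean_space set"
  assumes "DIM('a) \<ge> 2" "K \<in> norm_bodies" "polytope K"
  shows "\<not> smooth_body K"
proof
  assume smooth: "smooth_body K"
  note K = centered_convexD[OF norm_bodies_centered[OF assms(2)]]
  obtain V where V: "finite V" "K = convex hull V" using assms(3) by (auto simp: polytope_def)
  \<comment> \<open>Otherwise all generators lie in an open half-space, and so does their hull,
    although the support value is attained in \<open>K\<close>.\<close>
  have "\<exists>v\<in>V. u \<bullet> v = support_function K u" for u
  proof (rule ccontr)
    assume *: "\<not> (\<exists>v\<in>V. u \<bullet> v = support_function K u)"
    have "V \<subseteq> {x. u \<bullet> x < support_function K u}"
    proof
      fix x assume "x \<in> V"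
      moreover from this have "x \<in> K" unfolding V(2) by (rule hull_inc)
      ultimately show "x \<in> {x. u \<bullet> x < support_function K u}"
        using * support_function_ge[OF K(1), of x u] by force
    qed
    then have "K \<subseteq> {x. u \<bullet> x < support_function K u}"
      unfolding V(2) by (rule hull_minimal) (rule convex_halfspace_lt)
    moreover obtain x where "x \<in> K" "u \<bullet> x = support_function K u"
      using support_function_attains[OF K(1,3)] .
    ultimately show False by auto
  qed
  then obtain f where f: "\<And>u. f u \<in> V" "\<And>u. u \<bullet> f u = support_function K u" by metis
  \<comment> \<open>By smoothness a generator is chosen for at most one unit normal, so an infinite
    sphere would embed in the finite set \<open>V\<close>.\<close>
  have "inj_on f (sphere 0 1)"
  proof (rule inj_onI)
    fix u v assume "u \<in> sphere 0 1" "v \<in> sphere 0 1" "f u = f v"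
    moreover have "f u \<in> K" using f(1) unfolding V(2) by (intro hull_inc)
    ultimately show "u = v"
      using smooth f(2)[of u] f(2)[of v] unfolding smooth_body_iff[OF assms(2)] by auto
  qed
  then have "finite (sphere (0::'a) 1)" using f(1) V(1) by (auto intro: inj_on_finite[of f _ V])
  with infinite_sphere[OF assms(1)] show False by simp
qed

section \<open>Centered segments\<close>

lemma centered_convex_segment: "centered_convex (closed_segment (- e) e)"
  unfolding centered_convex_def
proof (intro conjI uminus_image_eqI)
  fix x assume "x \<in> closed_segment (- e) e"
  then obtain u where "0 \<le> u" "u \<le> 1" "x = (1 - u) *\<^sub>R (- e) + u *\<^sub>R e" by (auto simp: in_segment)
  then show "- x \<in> closed_segment (- e) e"
    unfolding in_segment by (intro exI[of _ "1 - u"]) (simp add: algebra_simps)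
qed auto

lemma outer_radius_segment: "outer_radius (closed_segment (- e) e) = norm e"
proof (rule antisym)
  have "closed_segment (- e) e \<subseteq> cball 0 (norm e)" by (intro closed_segment_subset) auto
  then show "outer_radius (closed_segment (- e) e) \<le> norm e"
    by (intro outer_radius_least) auto
  show "norm e \<le> outer_radius (closed_segment (- e) e)" by (intro outer_radius_ge) auto
qed

lemma support_function_segment_orthogonal:
  assumes "u \<bullet> e = 0"
  shows "support_function (closed_segment (- e) e) u = 0"
proof -
  have "u \<bullet> x = 0" if "x \<in> closed_segment (- e) e" for x
    using that assms by (auto simp: in_segment inner_add_right inner_diff_right)
  then show ?thesis
    using support_function_attains[of "closed_segment (- e) e" u]
      centered_convexD(1,3)[OF centered_convex_segment[of e]] by metis
qed

lemma unit_orthogonal_exists: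
  fixes e :: "'a::euclidean_space"
  assumes "DIM('a) \<ge> 2"
  obtains u where "norm u = 1" "u \<bullet> e = 0"
proof -
  obtain x where "x \<noteq> 0" "orthogonal e x" using orthogonal_to_vector_exists[OF assms] .
  then have "norm (sgn x) = 1" "sgn x \<bullet> e = 0"
    by (auto simp: norm_sgn orthogonal_def inner_commute sgn_div_norm)
  with that show thesis by blast
qed

text \<open>In dimension at least two some unit vector is orthogonal to \<open>e\<close>, and the
  support function vanishes there.\<close>

lemma inner_radius_segment:
  fixes e :: "'a::euclidean_space"
  assumes "DIM('a) \<ge> 2"
  shows "inner_radius (closed_segment (- e) e) = 0"
proof (rule antisym)
  obtain u where "norm u = 1" "u \<bullet> e = 0" using unit_orthogonal_exists[OF assms] .
  then show "inner_radius (closed_segment (- e) e) \<le> 0"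
    using inner_radius_le[OF centered_convexD(1,3)[OF centered_convex_segment], of u e]
      support_function_segment_orthogonal[of u e] by simp
  show "0 \<le> inner_radius (closed_segment (- e) e)"
  proof (rule inner_radius_greatest)
    fix u
    show "0 \<le> support_function (closed_segment (- e) e) u"
      using support_function_ge[OF centered_convexD(1,5)[OF centered_convex_segment[of e]], of u] by simp
  qed
qed

section \<open>Borel sets of norm bodies\<close>

lemma space_borel_norm_bodies [simp]: "space borel_norm_bodies = norm_bodies"
  unfolding borel_norm_bodies_def
  by (rule space_measure_of) (use openin_subset[of norm_space.mtopology] in auto)

lemma open_in_borel_norm_bodies:
  assumes "openin norm_space.mtopology U"
  shows "U \<in> sets borel_norm_bodies"
  unfolding borel_norm_bodies_def
  using assms openin_subset[of norm_space.mtopology] by (subst sets_measure_of) auto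

lemma closed_in_borel_norm_bodies:
  assumes "closedin norm_space.mtopology A"
  shows "A \<in> sets borel_norm_bodies"
proof -
  have "openin norm_space.mtopology (norm_bodies - A)" "A \<subseteq> norm_bodies"
    using assms by (auto simp: closedin_def)
  then have "norm_bodies - (norm_bodies - A) \<in> sets borel_norm_bodies"
    using sets.compl_sets[OF open_in_borel_norm_bodies] by fastforce
  then show ?thesis using \<open>A \<subseteq> norm_bodies\<close> by (simp add: double_diff)
qed

text \<open>Strict sublevel sets are open: the ball of radius \<open>y - f K\<close> about
  \<open>K\<close> stays below the level \<open>y\<close>.\<close>

lemma borel_measurable_lipschitz:
  assumes lip: "\<And>K L. K \<in> norm_bodies \<Longrightarrow> L \<in> norm_bodies \<Longrightarrow> f K \<le> f L + hausdorff_distance K L"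
  shows "f \<in> borel_measurable borel_norm_bodies"
proof (rule borel_measurableI_less, rule open_in_borel_norm_bodies)
  fix y
  show "openin norm_space.mtopology {K \<in> space borel_norm_bodies. f K < y}"
    unfolding norm_space.openin_mtopology
  proof (intro conjI allI impI)
    fix K assume K: "K \<in> {K \<in> space borel_norm_bodies. f K < y}"
    have "f L < y" if "L \<in> norm_space.mball K (y - f K)" for L
      using that K lip[of L K] by (auto simp: hausdorff_distance_commute)
    then show "\<exists>r>0. norm_space.mball K r \<subseteq> {K \<in> space borel_norm_bodies. f K < y}"
      using K by (intro exI[of _ "y - f K"]) auto
  qed auto
qed

lemma radii_measurable [measurable]:
  "outer_radius \<in> borel_measurable borel_norm_bodies" "inner_radius \<in> borel_measurable borel_norm_bodies"
  by (intro borel_measurable_lipschitz outer_radius_lipschitz inner_radius_lipschitz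
    centered_convexD(1,3)[OF norm_bodies_centered]; assumption)+

lemma thinness_measurable: "thinness \<in> measurable borel_norm_bodies (restrict_space borel {1/2..<1})"
proof (rule measurable_restrict_space2)
  show "thinness \<in> space borel_norm_bodies \<rightarrow> {1/2..<1}" by (auto dest: thinness_range)
  have "(\<lambda>K. outer_radius K / (inner_radius K + outer_radius K)) \<in> borel_measurable borel_norm_bodies"
    by measurable
  then show "thinness \<in> borel_measurable borel_norm_bodies"
    by (subst measurable_cong[OF thinness_norm_body]) auto
qed

text \<open>Domination of the Hausdorff distance by the increments of a continuous \<open>g\<close>
  makes \<open>f\<close> continuous. It is applied to curves of parallel bodies, with
  \<open>g\<close> the radius of the added ball.\<close>

lemma openin_lipschitz_vimage:
  fixes f :: "real \<Rightarrow> 'a::euclidean_space set" and g :: "real \<Rightarrow> real"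
  assumes U: "openin norm_space.mtopology U" and g: "continuous_on A g"
    and f: "\<And>x. x \<in> A \<Longrightarrow> f x \<in> norm_bodies"
    and lip: "\<And>x y. x \<in> A \<Longrightarrow> y \<in> A \<Longrightarrow> hausdorff_distance (f x) (f y) \<le> \<bar>g x - g y\<bar>"
  shows "openin (top_of_set A) {x \<in> A. f x \<in> U}"
  unfolding openin_euclidean_subtopology_iff
proof (intro conjI ballI)
  fix x assume x: "x \<in> {x \<in> A. f x \<in> U}"
  then obtain r where r: "r > 0" "norm_space.mball (f x) r \<subseteq> U"
    using U unfolding norm_space.openin_mtopology by auto
  obtain d where d: "d > 0" "\<And>y. y \<in> A \<Longrightarrow> dist y x < d \<Longrightarrow> dist (g y) (g x) < r"
    using g x r(1) unfolding continuous_on_iff by blast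
  have "y \<in> {x \<in> A. f x \<in> U}" if "y \<in> A" "dist y x < d" for y
    using d(2)[OF that] lip[of x y] x r(2) that f[of x] f[of y]
    by (force simp: dist_real_def abs_minus_commute subset_iff)
  then show "\<exists>e>0. \<forall>y\<in>A. dist y x < e \<longrightarrow> y \<in> {x \<in> A. f x \<in> U}" using d(1) by blast
qed auto

lemma measurable_lipschitz_curve:
  fixes f :: "real \<Rightarrow> 'a::euclidean_space set" and g :: "real \<Rightarrow> real"
  assumes "continuous_on A g" "\<And>x. x \<in> A \<Longrightarrow> f x \<in> norm_bodies"
    and "\<And>x y. x \<in> A \<Longrightarrow> y \<in> A \<Longrightarrow> hausdorff_distance (f x) (f y) \<le> \<bar>g x - g y\<bar>"
  shows "f \<in> measurable (restrict_space borel A) borel_norm_bodies"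
  unfolding borel_norm_bodies_def
proof (rule measurable_measure_of)
  show "{U. openin norm_space.mtopology U} \<subseteq> Pow norm_bodies"
    using openin_subset[of norm_space.mtopology] by auto
  show "f \<in> space (restrict_space borel A) \<rightarrow> norm_bodies" using assms(2) by (auto simp: space_restrict_space)
  fix U :: "'a set set" assume "U \<in> {U. openin norm_space.mtopology U}"
  then have "openin (top_of_set A) {x \<in> A. f x \<in> U}" using openin_lipschitz_vimage[OF _ assms] by simp
  then obtain T where T: "open T" "{x \<in> A. f x \<in> U} = A \<inter> T" by (auto simp: openin_open)
  moreover have "f -` U \<inter> space (restrict_space borel A) = {x \<in> A. f x \<in> U}"
    by (auto simp: space_restrict_space)
  ultimately show "f -` U \<inter> space (restrict_space borel A) \<in> sets (restrict_space borel A)"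
    by (auto simp: sets_restrict_space)
qed

section \<open>Limits of bodies: measurability of smoothness and of being a polytope\<close>

lemma support_attained_limit:
  fixes \<sigma> :: "nat \<Rightarrow> 'a::euclidean_space set"
  assumes \<sigma>: "\<And>j. \<sigma> j \<in> norm_bodies" and K: "K \<in> norm_bodies"
    and lim: "(\<lambda>j. hausdorff_distance (\<sigma> j) K) \<longlonglongrightarrow> 0"
    and x: "\<And>j. x j \<in> \<sigma> j" "x \<longlonglongrightarrow> y"
  shows "y \<in> K"
    and "\<lbrakk>\<And>j. u j \<bullet> x j = support_function (\<sigma> j) (u j); \<And>j. norm (u j) = 1; u \<longlonglongrightarrow> v\<rbrakk>
      \<Longrightarrow> v \<bullet> y = support_function K v"
proof -
  note k = centered_convexD[OF norm_bodies_centered[OF K]]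
  note s = centered_convexD[OF norm_bodies_centered[OF \<sigma>]]
  have "infdist (x j) K \<le> hausdorff_distance (\<sigma> j) K" for j
    using infdist_le_hausdorff_distance[OF x(1) k(3)] s(1) k(1) by (auto intro: compact_imp_bounded)
  then have "infdist y K \<le> 0"
    using LIMSEQ_le[OF tendsto_infdist[OF x(2)] lim] by blast
  then show y: "y \<in> K"
    using in_closed_iff_infdist_zero[OF compact_imp_closed[OF k(1)] k(3), of y] infdist_nonneg[of y K] by auto
  assume u: "\<And>j. u j \<bullet> x j = support_function (\<sigma> j) (u j)" "\<And>j. norm (u j) = 1" "u \<longlonglongrightarrow> v"
  \<comment> \<open>Being an outer normal at a point is a closed condition: for the approximating
    bodies the inequality holds up to the Hausdorff distance, and this error vanishes in the
    limit.\<close>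
  have "v \<bullet> z \<le> v \<bullet> y" if z: "z \<in> K" for z
  proof (rule LIMSEQ_le)
    show "(\<lambda>j. u j \<bullet> z) \<longlonglongrightarrow> v \<bullet> z" by (intro tendsto_intros u)
    have "(\<lambda>j. u j \<bullet> x j + hausdorff_distance (\<sigma> j) K) \<longlonglongrightarrow> v \<bullet> y + 0"
      by (intro tendsto_intros u x lim)
    then show "(\<lambda>j. u j \<bullet> x j + hausdorff_distance (\<sigma> j) K) \<longlonglongrightarrow> v \<bullet> y" by simp
    have "u j \<bullet> z \<le> u j \<bullet> x j + hausdorff_distance (\<sigma> j) K" for j
      using support_function_ge[OF k(1) z, of "u j"] support_function_lipschitz[OF k(1,3) s(1,3) u(2), of j j]
      by (simp add: u(1) hausdorff_distance_commute)
    then show "\<exists>N. \<forall>n\<ge>N. u n \<bullet> z \<le> u n \<bullet> x n + hausdorff_distance (\<sigma> n) K" by blast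
  qed
  then show "v \<bullet> y = support_function K v"
    using support_function_ge[OF k(1) y, of v] support_function_least[OF k(3), of v "v \<bullet> y"]
    by (intro antisym) auto
qed

text \<open>The distances to \<open>K\<close> converge and are therefore bounded, which bounds all
  outer radii at once.\<close>

lemma hausdorff_convergent_bounded:
  fixes \<sigma> :: "nat \<Rightarrow> 'a::euclidean_space set"
  assumes \<sigma>: "\<And>j. \<sigma> j \<in> norm_bodies" and K: "K \<in> norm_bodies"
    and lim: "(\<lambda>j. hausdorff_distance (\<sigma> j) K) \<longlonglongrightarrow> 0"
  obtains B where "\<And>j. \<sigma> j \<subseteq> cball 0 B"
proof -
  obtain b where b: "\<And>j. hausdorff_distance (\<sigma> j) K \<le> b"
    using convergent_imp_Bseq[of "\<lambda>j. hausdorff_distance (\<sigma> j) K"] lim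
    by (auto simp: Bseq_def convergent_def)
  have "norm x \<le> outer_radius K + b" if "x \<in> \<sigma> j" for x j
  proof -
    note s = centered_convexD[OF norm_bodies_centered[OF \<sigma>[of j]]]
      and k = centered_convexD[OF norm_bodies_centered[OF K]]
    show ?thesis
      using outer_radius_ge[OF s(1) that] outer_radius_lipschitz[OF s(1,3) k(1,3)] b[of j] by linarith
  qed
  then have "\<And>j. \<sigma> j \<subseteq> cball 0 (outer_radius K + b)" by auto
  with that show thesis by blast
qed

lemma closedin_norm_bodiesI:
  assumes "A \<subseteq> norm_bodies"
    and "\<And>\<sigma> K. (\<And>j. \<sigma> j \<in> A) \<Longrightarrow> K \<in> norm_bodies \<Longrightarrow> (\<lambda>j. hausdorff_distance (\<sigma> j) K) \<longlonglongrightarrow> 0 \<Longrightarrow> K \<in> A"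
  shows "closedin norm_space.mtopology A"
  unfolding norm_space.metric_closedin_iff_sequentially_closed norm_space.limitin_metric_dist_null
  using assms by blast

text \<open>Two distinct normals may merge in a limit; for positive \<epsilon> the required gap
  prevents this. Points and normals range over a compact set, so a subsequence of the triples
  converges.\<close>

lemma closedin_separated_normals:
  "closedin norm_space.mtopology {K \<in> norm_bodies. \<exists>x\<in>K. \<exists>u v. norm u = 1 \<and> norm v = 1 \<and>
      \<epsilon> \<le> norm (u - v) \<and> u \<bullet> x = support_function K u \<and> v \<bullet> x = support_function K v}"
  (is "closedin _ ?A")
proof (rule closedin_norm_bodiesI)
  fix \<sigma> :: "nat \<Rightarrow> 'a set" and K
  assume "\<And>j. \<sigma> j \<in> ?A" and K: "K \<in> norm_bodies" and lim: "(\<lambda>j. hausdorff_distance (\<sigma> j) K) \<longlonglongrightarrow> 0"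
  then have \<sigma>: "\<And>j. \<sigma> j \<in> norm_bodies" and "\<And>j. \<exists>x u v. x \<in> \<sigma> j \<and> norm u = 1 \<and> norm v = 1 \<and>
      \<epsilon> \<le> norm (u - v) \<and> u \<bullet> x = support_function (\<sigma> j) u \<and> v \<bullet> x = support_function (\<sigma> j) v"
    by blast+
  then obtain x u v where x: "\<And>j. x j \<in> \<sigma> j" and u: "\<And>j. norm (u j) = 1" and v: "\<And>j. norm (v j) = 1"
    and uv: "\<And>j. \<epsilon> \<le> norm (u j - v j)"
    and ux: "\<And>j. u j \<bullet> x j = support_function (\<sigma> j) (u j)"
    and vx: "\<And>j. v j \<bullet> x j = support_function (\<sigma> j) (v j)"
    by metis
  obtain B where B: "\<And>j. \<sigma> j \<subseteq> cball 0 B" using hausdorff_convergent_bounded[OF \<sigma> K lim] by metis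
  have "compact (cball (0::'a) B \<times> sphere (0::'a) 1 \<times> sphere (0::'a) 1)"
    by (intro compact_Times compact_cball compact_sphere)
  moreover have "(x j, u j, v j) \<in> cball 0 B \<times> sphere 0 1 \<times> sphere 0 1" for j
    using x[of j] u[of j] v[of j] subsetD[OF B, of "x j" j] by simp
  ultimately obtain p r where p: "p \<in> cball 0 B \<times> sphere 0 1 \<times> sphere 0 1" and r: "strict_mono r"
    and conv: "((\<lambda>j. (x j, u j, v j)) \<circ> r) \<longlonglongrightarrow> p"
    unfolding compact_def by meson
  obtain y a b where p_eq: "p = (y, a, b)" by (cases p)
  have xr: "(\<lambda>j. x (r j)) \<longlonglongrightarrow> y" and ur: "(\<lambda>j. u (r j)) \<longlonglongrightarrow> a" and vr: "(\<lambda>j. v (r j)) \<longlonglongrightarrow> b"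
    using tendsto_fst[OF conv] tendsto_fst[OF tendsto_snd[OF conv]] tendsto_snd[OF tendsto_snd[OF conv]]
    by (auto simp: p_eq o_def)
  note limr = LIMSEQ_subseq_LIMSEQ[OF lim r, unfolded o_def]
  note att = support_attained_limit[of "\<lambda>j. \<sigma> (r j)", OF \<sigma> K limr x xr]
  have "\<epsilon> \<le> norm (a - b)"
    using uv by (intro LIMSEQ_le_const[OF tendsto_norm[OF tendsto_diff[OF ur vr]]]) auto
  then show "K \<in> ?A"
    using K p att(1) att(2)[OF ux u ur] att(2)[OF vx v vr] unfolding p_eq by auto
qed auto

text \<open>The nonsmooth bodies are the countable union over \<open>n\<close> of the closed sets of
  bodies with two normals at one point at least \<open>1 / Suc n\<close> apart.\<close>

lemma smooth_bodies_measurable: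
  "{K \<in> norm_bodies :: 'a::euclidean_space set set. smooth_body K} \<in> sets borel_norm_bodies"
proof -
  define A where "A n = {K \<in> norm_bodies :: 'a set set. \<exists>x\<in>K. \<exists>u v. norm u = 1 \<and> norm v = 1 \<and>
      1 / Suc n \<le> norm (u - v) \<and> u \<bullet> x = support_function K u \<and> v \<bullet> x = support_function K v}" for n
  have "A n \<in> sets borel_norm_bodies" for n
    unfolding A_def by (intro closed_in_borel_norm_bodies closedin_separated_normals)
  then have "norm_bodies - (\<Union>n. A n) \<in> sets borel_norm_bodies"
    using sets.compl_sets[of "\<Union>n. A n" borel_norm_bodies] by auto
  also have "norm_bodies - (\<Union>n. A n) = {K \<in> norm_bodies. smooth_body K}"
  proof (intro equalityI subsetI)
    fix K assume K: "K \<in> norm_bodies - (\<Union>n. A n)"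
    have "u = v" if "x \<in> K" "norm u = 1" "norm v = 1" "u \<bullet> x = support_function K u"
      "v \<bullet> x = support_function K v" for x u v
    proof (rule ccontr)
      assume "u \<noteq> v"
      then obtain n where "1 / Suc n < norm (u - v)" using reals_Archimedean[of "norm (u - v)"]
        by (auto simp: inverse_eq_divide)
      with that have "\<exists>x\<in>K. \<exists>u v. norm u = 1 \<and> norm v = 1 \<and> 1 / Suc n \<le> norm (u - v) \<and>
          u \<bullet> x = support_function K u \<and> v \<bullet> x = support_function K v"
        by (intro bexI[of _ x] exI[of _ u] exI[of _ v] conjI less_imp_le)
      with K have "K \<in> A n" by (simp add: A_def)
      with K show False by blast
    qed
    with K show "K \<in> {K \<in> norm_bodies. smooth_body K}" by (auto simp: smooth_body_iff)
  next
    fix K :: "'a set" assume K: "K \<in> {K \<in> norm_bodies. smooth_body K}"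
    then have "K \<notin> A n" for n using smooth_body_iff[of K] unfolding A_def by fastforce
    with K show "K \<in> norm_bodies - (\<Union>n. A n)" by blast
  qed
  finally show ?thesis .
qed

text \<open>Bolzano-Weierstrass is applied to one index after the other, each time passing to a
  further subsequence.\<close>

lemma convergent_subsequence_finite:
  fixes p :: "nat \<Rightarrow> nat \<Rightarrow> 'a::heine_borel"
  assumes "\<And>i. i < m \<Longrightarrow> bounded (range (\<lambda>j. p j i))"
  obtains r q where "strict_mono (r :: nat \<Rightarrow> nat)" "\<And>i. i < m \<Longrightarrow> (\<lambda>j. p (r j) i) \<longlonglongrightarrow> q i"
proof -
  have "\<exists>r q. strict_mono (r :: nat \<Rightarrow> nat) \<and> (\<forall>i<m. (\<lambda>j. p (r j) i) \<longlonglongrightarrow> q i)"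
    using assms
  proof (induction m)
    case 0
    show ?case by (intro exI[of _ id]) (auto simp: strict_mono_def)
  next
    case (Suc m)
    then obtain r q where r: "strict_mono r" "\<And>i. i < m \<Longrightarrow> (\<lambda>j. p (r j) i) \<longlonglongrightarrow> q i" by auto
    have "bounded (range (\<lambda>j. p (r j) m))"
      by (rule bounded_subset[OF Suc.prems[of m]]) auto
    then obtain l r' where r': "strict_mono r'" "((\<lambda>j. p (r j) m) \<circ> r') \<longlonglongrightarrow> l"
      using bounded_imp_convergent_subsequence by metis
    have "(\<lambda>j. p (r (r' j)) i) \<longlonglongrightarrow> (q(m := l)) i" if "i < Suc m" for i
    proof (cases "i = m")
      case True
      then show ?thesis using r'(2) by (simp add: o_def)
    next
      case False
      then show ?thesis using that LIMSEQ_subseq_LIMSEQ[OF r(2) r'(1), of i] by (simp add: o_def)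
    qed
    moreover have "strict_mono (\<lambda>j. r (r' j))" using strict_mono_o[OF r(1) r'(1)] by (simp add: o_def)
    ultimately show ?case by blast
  qed
  with that show thesis by blast
qed

text \<open>Along a subsequence the \<open>m\<close> generators converge, and the limit body is the
  hull of their limits. The map \<open>p\<close> may repeat points, so generators are allowed to
  merge.\<close>

lemma closedin_hulls_of_card:
  "closedin norm_space.mtopology {K \<in> norm_bodies. \<exists>p. K = convex hull (p ` {..<m::nat})}"
  (is "closedin _ ?A")
proof (rule closedin_norm_bodiesI)
  fix \<sigma> :: "nat \<Rightarrow> 'a set" and K
  assume "\<And>j. \<sigma> j \<in> ?A" and K: "K \<in> norm_bodies" and lim: "(\<lambda>j. hausdorff_distance (\<sigma> j) K) \<longlonglongrightarrow> 0"
  then have \<sigma>: "\<And>j. \<sigma> j \<in> norm_bodies" and "\<And>j. \<exists>p. \<sigma> j = convex hull (p ` {..<m})" by blast+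
  then obtain p where p: "\<And>j. \<sigma> j = convex hull (p j ` {..<m})" by metis
  note k = centered_convexD[OF norm_bodies_centered[OF K]]
  note s = centered_convexD[OF norm_bodies_centered[OF \<sigma>]]
  have mem: "p j i \<in> \<sigma> j" if "i < m" for i j unfolding p using that by (intro hull_inc) auto
  obtain B where B: "\<And>j. \<sigma> j \<subseteq> cball 0 B" using hausdorff_convergent_bounded[OF \<sigma> K lim] by metis
  have "bounded (range (\<lambda>j. p j i))" if "i < m" for i
    using mem[OF that] B by (intro boundedI[of _ B]) force
  then obtain r q where r: "strict_mono r" and q: "\<And>i. i < m \<Longrightarrow> (\<lambda>j. p (r j) i) \<longlonglongrightarrow> q i"
    using convergent_subsequence_finite by metis
  note limr = LIMSEQ_subseq_LIMSEQ[OF lim r, unfolded o_def]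
  let ?H = "convex hull (q ` {..<m})"
  have "q i \<in> K" if "i < m" for i
    using support_attained_limit(1)[of "\<lambda>j. \<sigma> (r j)", OF \<sigma> K limr mem[OF that] q[OF that]] .
  then have "?H \<subseteq> K" by (intro hull_minimal k(2)) auto
  moreover have "K \<subseteq> ?H"
  proof
    fix y assume y: "y \<in> K"
    \<comment> \<open>The total displacement of the generators dominates each single one, so the
      approximating hull lies in the parallel body of \<open>?H\<close> at distance
      \<open>\<delta> j\<close>.\<close>
    define \<delta> where "\<delta> j = (\<Sum>i<m. dist (p (r j) i) (q i))" for j
    have "(\<lambda>j. hausdorff_distance (\<sigma> (r j)) K + \<delta> j) \<longlonglongrightarrow> 0 + (\<Sum>i<m. dist (q i) (q i))"
      unfolding \<delta>_def by (intro tendsto_add limr tendsto_sum tendsto_dist q tendsto_const) auto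
    moreover have "infdist y ?H \<le> hausdorff_distance (\<sigma> (r j)) K + \<delta> j" for j
    proof -
      obtain z where z: "z \<in> \<sigma> (r j)" "dist y z \<le> hausdorff_distance (\<sigma> (r j)) K"
        using hausdorff_distance_attains[OF y k(1) s(1,3), of "r j"] by (auto simp: hausdorff_distance_commute)
      have "\<sigma> (r j) \<subseteq> ?H + cball 0 (\<delta> j)"
        unfolding p
      proof (rule hull_minimal)
        show "convex (?H + cball 0 (\<delta> j))" by (intro convex_set_plus convex_convex_hull convex_cball)
        show "p (r j) ` {..<m} \<subseteq> ?H + cball 0 (\<delta> j)"
        proof (intro image_subsetI)
          fix i assume i: "i \<in> {..<m}"
          then have "dist (p (r j) i) (q i) \<le> \<delta> j" unfolding \<delta>_def by (intro member_le_sum) auto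
          then have "q i + (p (r j) i - q i) \<in> ?H + cball 0 (\<delta> j)"
            using i by (intro set_plus_intro hull_inc) (auto simp: dist_norm norm_minus_commute)
          then show "p (r j) i \<in> ?H + cball 0 (\<delta> j)" by simp
        qed
      qed
      with z(1) have "z \<in> ?H + cball 0 (\<delta> j)" by blast
      then obtain h w where h: "h \<in> ?H" "w \<in> cball 0 (\<delta> j)" "z = h + w" by (auto elim: set_plus_elim)
      then have "infdist y ?H \<le> dist y h" by (intro infdist_le)
      also have "\<dots> \<le> dist y z + dist z h" by (rule dist_triangle)
      also have "dist z h \<le> \<delta> j" using h by (simp add: dist_norm)
      finally show ?thesis using z(2) by linarith
    qed
    ultimately have "infdist y ?H \<le> 0"
      by (intro LIMSEQ_le_const[of _ 0]) auto
    moreover have "?H \<noteq> {}" using s(3)[of 0] p[of 0] by auto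
    moreover have "closed ?H" by (intro compact_imp_closed finite_imp_compact_convex_hull) auto
    ultimately show "y \<in> ?H"
      using in_closed_iff_infdist_zero[of ?H y] infdist_nonneg[of y ?H] by auto
  qed
  ultimately show "K \<in> ?A" using K by blast
qed auto

lemma polytopes_measurable:
  "{K \<in> norm_bodies :: 'a::euclidean_space set set. polytope K} \<in> sets borel_norm_bodies"
proof -
  have "{K \<in> norm_bodies :: 'a set set. polytope K} =
      (\<Union>m::nat. {K \<in> norm_bodies. \<exists>p. K = convex hull (p ` {..<m})})"
  proof (intro equalityI subsetI)
    fix K :: "'a set" assume K: "K \<in> {K \<in> norm_bodies. polytope K}"
    then obtain V where V: "finite V" "K = convex hull V" by (auto simp: polytope_def)
    from finite_imp_nat_seg_image_inj_on[OF V(1)] obtain m p where "V = p ` {i::nat. i < m}" by blast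
    then have "K = convex hull (p ` {..<m})" using V(2) by (simp add: lessThan_def)
    with K show "K \<in> (\<Union>m::nat. {K \<in> norm_bodies. \<exists>p. K = convex hull (p ` {..<m})})" by blast
  next
    fix K :: "'a set" assume "K \<in> (\<Union>m::nat. {K \<in> norm_bodies. \<exists>p. K = convex hull (p ` {..<m})})"
    then show "K \<in> {K \<in> norm_bodies. polytope K}" by (auto simp: polytope_def)
  qed
  then show ?thesis
    by (simp only:) (intro sets.countable_UN image_subsetI closed_in_borel_norm_bodies closedin_hulls_of_card)
qed

section \<open>Density of parallel bodies of polytopes\<close>

text \<open>The origin is inserted so that the hull is nonempty even for empty
  \<open>F\<close>.\<close>

definition symmetric_hull :: "'a::euclidean_space set \<Rightarrow> 'a set" where
  "symmetric_hull F = convex hull (insert 0 (F \<union> uminus ` F))"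

lemma centered_convex_symmetric_hull:
  assumes "finite F"
  shows "centered_convex (symmetric_hull F)"
  unfolding centered_convex_def
proof (intro conjI)
  have "uminus ` insert 0 (F \<union> uminus ` F) = insert 0 (F \<union> uminus ` F)"
    by (rule uminus_image_eqI) auto
  then show "uminus ` symmetric_hull F = symmetric_hull F"
    unfolding symmetric_hull_def by (metis convex_hull_linear_image linear_uminus)
qed (use assms in \<open>auto simp: symmetric_hull_def intro: finite_imp_compact_convex_hull\<close>)

text \<open>Finitely many balls of radius \<delta> with centers in \<open>D\<close> cover
  \<open>K\<close>, so \<open>K\<close> lies in the parallel body of the hull of the centers. That
  hull in turn lies within \<delta> of \<open>K\<close>, and adding the ball costs another
  \<delta>.\<close>

lemma symmetric_hull_approximates:
  fixes K :: "'a::euclidean_space set"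
  assumes D: "\<And>U. open U \<Longrightarrow> U \<noteq> {} \<Longrightarrow> \<exists>y\<in>D. y \<in> U" and K: "K \<in> norm_bodies" and \<delta>: "\<delta> > 0"
  obtains F where "finite F" "F \<subseteq> D" "hausdorff_distance K (symmetric_hull F + cball 0 \<delta>) \<le> 2 * \<delta>"
proof -
  note k = centered_convexD[OF norm_bodies_centered[OF K]]
  have "K \<subseteq> (\<Union>c\<in>D. ball c \<delta>)"
  proof
    fix x assume "x \<in> K"
    obtain c where "c \<in> D" "c \<in> ball x \<delta>" using D[of "ball x \<delta>"] \<delta> by auto
    then show "x \<in> (\<Union>c\<in>D. ball c \<delta>)" by (auto simp: dist_commute)
  qed
  then obtain T where T: "T \<subseteq> D" "finite T" "K \<subseteq> (\<Union>c\<in>T. ball c \<delta>)"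
    using compactE_image[OF k(1), of D "\<lambda>c. ball c \<delta>"] by auto
  \<comment> \<open>Centers whose ball misses \<open>K\<close> are dropped, since they could lie
    farther than \<delta> from \<open>K\<close>.\<close>
  define F where "F = {c \<in> T. ball c \<delta> \<inter> K \<noteq> {}}"
  have F: "finite F" "F \<subseteq> D" using T by (auto simp: F_def)
  note c = centered_convex_symmetric_hull[OF F(1)]
  note g = centered_convexD[OF norm_bodies_centered[OF norm_bodies_parallel[OF c \<delta>]]]
  have sub: "symmetric_hull F \<subseteq> K + cball 0 \<delta>"
    unfolding symmetric_hull_def
  proof (rule hull_minimal)
    have "c \<in> K + cball 0 \<delta> \<and> - c \<in> K + cball 0 \<delta>" if c: "c \<in> F" for c
    proof -
      obtain x where x: "x \<in> K" "dist c x < \<delta>" using c by (auto simp: F_def)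
      have "x + (c - x) \<in> K + cball 0 \<delta>" "- x + (x - c) \<in> K + cball 0 \<delta>"
        using x k(4) by (intro set_plus_intro; simp add: dist_norm norm_minus_commute)+
      then show ?thesis by simp
    qed
    moreover have "0 + 0 \<in> K + cball 0 \<delta>" using k(5) \<delta> by (intro set_plus_intro) auto
    ultimately show "insert 0 (F \<union> uminus ` F) \<subseteq> K + cball 0 \<delta>" by auto
  qed (intro convex_set_plus k(2) convex_cball)
  have "hausdorff_distance K (symmetric_hull F + cball 0 \<delta>) \<le> 2 * \<delta>"
  proof (rule hausdorff_distance_leI)
    fix x assume "x \<in> K"
    then obtain c where "c \<in> T" "x \<in> ball c \<delta>" using T(3) by auto
    then have c: "c \<in> F" "norm (x - c) \<le> \<delta>"
      using \<open>x \<in> K\<close> by (auto simp: F_def dist_norm norm_minus_commute)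
    have "c + (x - c) \<in> symmetric_hull F + cball 0 \<delta>"
      using c by (intro set_plus_intro) (auto simp: symmetric_hull_def intro: hull_inc)
    then show "\<exists>b\<in>symmetric_hull F + cball 0 \<delta>. dist x b \<le> 2 * \<delta>"
      using \<delta> by (intro bexI[of _ x]) auto
  next
    fix x assume "x \<in> symmetric_hull F + cball 0 \<delta>"
    then obtain c z where z: "c \<in> symmetric_hull F" "z \<in> cball 0 \<delta>" "x = c + z" by (auto elim: set_plus_elim)
    then obtain y w where y: "y \<in> K" "w \<in> cball 0 \<delta>" "c = y + w" using sub by (auto elim!: set_plus_elim)
    have "dist x y \<le> 2 * \<delta>"
      using norm_triangle_ineq[of w z] y z by (simp add: dist_norm)
    with y(1) show "\<exists>a\<in>K. dist x a \<le> 2 * \<delta>" by blast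
  qed (use k g in \<open>auto simp: compact_imp_bounded\<close>)
  with F that show thesis by blast
qed

text \<open>If the radii agree, the support function is constant on the unit sphere. Adding a short
  segment raises it in the direction \<open>e\<close> but not in an orthogonal direction. Distinct
  radii are needed because equal ones leave the thinness interval empty.\<close>

lemma open_contains_nonball:
  fixes U :: "'a::euclidean_space set set"
  assumes dim: "DIM('a) \<ge> 2" and U: "openin norm_space.mtopology U" and K: "K \<in> U"
  obtains L where "L \<in> U" "inner_radius L < outer_radius L"
proof (cases "inner_radius K < outer_radius K")
  case True
  with K that show thesis by blast
next
  case False
  obtain r where r: "r > 0" "norm_space.mball K r \<subseteq> U" and Kn: "K \<in> norm_bodies"
    using U K unfolding norm_space.openin_mtopology by blast
  note kc = norm_bodies_centered[OF Kn]
  note k = centered_convexD[OF kc]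
  have R: "inner_radius K = outer_radius K" using False norm_bodies_radii(2)[OF Kn] by simp
  have h: "support_function K u = outer_radius K" if "norm u = 1" for u
    using inner_radius_le[OF k(1,3) that] support_function_le_outer_radius[OF k(1,3) that] R by linarith
  obtain e :: 'a where e: "norm e = 1" using vector_choose_size[of 1] by auto
  define \<delta> where "\<delta> = r / 2"
  have \<delta>: "\<delta> > 0" "\<delta> < r" using r by (auto simp: \<delta>_def)
  let ?S = "closed_segment (- (\<delta> *\<^sub>R e)) (\<delta> *\<^sub>R e)"
  note S = centered_convex_segment[of "\<delta> *\<^sub>R e"]
  define L where "L = K + ?S"
  have "L = ?S + K" unfolding L_def by (rule add.commute)
  then have L: "L \<in> norm_bodies" using norm_bodies_plus[OF S Kn] by simp
  note l = centered_convexD[OF norm_bodies_centered[OF L]]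
  have "hausdorff_distance K L \<le> \<delta>"
    using hausdorff_distance_plus[OF kc S] outer_radius_segment[of "\<delta> *\<^sub>R e"] e \<delta>
    by (simp add: L_def hausdorff_distance_commute)
  then have "L \<in> U" using r \<delta> L Kn by (intro subsetD[OF r(2)]) simp
  moreover have "inner_radius L < outer_radius L"
  proof -
    obtain u where u: "norm u = 1" "u \<bullet> e = 0" using unit_orthogonal_exists[OF dim] .
    have "inner_radius L \<le> support_function L u" by (rule inner_radius_le[OF l(1,3) u(1)])
    also have "\<dots> = outer_radius K"
      using support_function_plus[OF kc S, of u] support_function_segment_orthogonal[of u "\<delta> *\<^sub>R e"] u h
      by (simp add: L_def)
    also have "\<dots> < support_function L e"
    proof -
      have "e \<bullet> (\<delta> *\<^sub>R e) \<le> support_function ?S e"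
        by (rule support_function_ge[OF centered_convexD(1)[OF S]]) simp
      then show ?thesis
        using support_function_plus[OF kc S, of e] h[OF e] e \<delta> by (simp add: L_def norm_eq_1)
    qed
    also have "\<dots> \<le> outer_radius L" using support_function_le_outer_radius[OF l(1,3) e] by linarith
    finally show ?thesis .
  qed
  ultimately show thesis using that by blast
qed

lemma open_contains_parallel_body:
  fixes U :: "'a::euclidean_space set set"
  assumes dim: "DIM('a) \<ge> 2" and U: "openin norm_space.mtopology U" "U \<noteq> {}"
    and D: "\<And>V. open V \<Longrightarrow> V \<noteq> {} \<Longrightarrow> \<exists>y\<in>D. y \<in> V"
  obtains F s where "finite F" "F \<subseteq> D" "s > 0" "symmetric_hull F + cball 0 s \<in> U"
    "inner_radius (symmetric_hull F) < outer_radius (symmetric_hull F)"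
proof -
  obtain K where K: "K \<in> U" "inner_radius K < outer_radius K"
    using open_contains_nonball[OF dim U(1)] U(2) by blast
  then obtain r where r: "r > 0" "norm_space.mball K r \<subseteq> U" and Kn: "K \<in> norm_bodies"
    using U(1) unfolding norm_space.openin_mtopology by blast
  \<comment> \<open>The approximation error is at most \<open>2 * s\<close>. This stays below
    \<open>r\<close>, and it shrinks the difference of the radii by at most \<open>4 * s\<close>,
    which keeps it positive. Removing the ball changes both radii equally.\<close>
  define s where "s = min r (outer_radius K - inner_radius K) / 5"
  have s: "s > 0" "2 * s < r" "4 * s < outer_radius K - inner_radius K"
    using r(1) K(2) by (auto simp: s_def min_def)
  obtain F where F: "finite F" "F \<subseteq> D" "hausdorff_distance K (symmetric_hull F + cball 0 s) \<le> 2 * s"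
    using symmetric_hull_approximates[OF D Kn s(1)] by metis
  note c = centered_convex_symmetric_hull[OF F(1)]
  let ?G = "symmetric_hull F + cball 0 s"
  have G: "?G \<in> norm_bodies" by (rule norm_bodies_parallel[OF c s(1)])
  note g = centered_convexD[OF norm_bodies_centered[OF G]] and k = centered_convexD[OF norm_bodies_centered[OF Kn]]
  have "?G \<in> U" using r(2) G Kn F(3) s by (intro subsetD[OF r(2)]) simp
  moreover have "inner_radius (symmetric_hull F) < outer_radius (symmetric_hull F)"
    using outer_radius_lipschitz[OF k(1,3) g(1,3)] inner_radius_lipschitz[OF g(1,3) k(1,3)] F(3) s
      outer_radius_parallel[OF c s(1)] inner_radius_parallel[OF c s(1)]
    by (simp add: hausdorff_distance_commute)
  ultimately show thesis using that F s by blast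
qed

section \<open>Random bodies of prescribed thinness\<close>

text \<open>The solution \<open>s\<close> of the equation
  \<open>(R + s) / (r + R + 2 * s) = t\<close>, with \<open>r\<close> and \<open>R\<close> the inner
  and outer radius of \<open>C\<close>.\<close>

definition parallel_radius :: "'a::euclidean_space set \<Rightarrow> real \<Rightarrow> real" where
  "parallel_radius C t =
    (outer_radius C - t * (inner_radius C + outer_radius C)) / (2 * t - 1)"

text \<open>The upper end is the limit of the thinness of \<open>C + cball 0 s\<close> as
  \<open>s\<close> tends to 0, the lower end its limit for large \<open>s\<close>. For
  \<open>C = {0}\<close> division by zero gives the value 0 and the interval is empty.\<close>

definition thinness_interval :: "'a::euclidean_space set \<Rightarrow> real set" where
  "thinness_interval C = {1/2<..<outer_radius C / (inner_radius C + outer_radius C)}"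

lemma thinness_parallel:
  assumes "centered_convex C" "s > 0"
  shows "thinness (C + cball 0 s)
    = (outer_radius C + s) / (inner_radius C + outer_radius C + 2 * s)"
  unfolding thinness_norm_body[OF norm_bodies_parallel[OF assms]] outer_radius_parallel[OF assms]
    inner_radius_parallel[OF assms] by (simp add: algebra_simps)

lemma centered_convex_radii:
  assumes "centered_convex C"
  shows "0 \<le> inner_radius C" "0 \<le> outer_radius C"
proof -
  note c = centered_convexD[OF assms]
  show "0 \<le> inner_radius C"
    using support_function_ge[OF c(1,5)] by (intro inner_radius_greatest) (metis inner_zero_right)
  then show "0 \<le> outer_radius C" using inner_radius_le_outer_radius[OF c(1,3)] by linarith
qed

lemma parallel_radius_pos:
  assumes "centered_convex C" "t \<in> thinness_interval C"
  shows "parallel_radius C t > 0"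
proof -
  have t: "1/2 < t" "t < outer_radius C / (inner_radius C + outer_radius C)"
    using assms(2) by (auto simp: thinness_interval_def)
  then have "inner_radius C + outer_radius C \<noteq> 0" by auto
  with centered_convex_radii[OF assms(1)] have "inner_radius C + outer_radius C > 0" by linarith
  with t show ?thesis by (simp add: parallel_radius_def field_simps)
qed

lemma thinness_parallel_radius:
  assumes "centered_convex C" "t \<in> thinness_interval C"
  shows "thinness (C + cball 0 (parallel_radius C t)) = t"
proof -
  define s where "s = parallel_radius C t"
  have s: "s > 0" using parallel_radius_pos[OF assms] by (simp add: s_def)
  have "1/2 < t" using assms(2) by (simp add: thinness_interval_def)
  then have "s * (2 * t - 1) = outer_radius C - t * (inner_radius C + outer_radius C)"
    by (simp add: s_def parallel_radius_def)
  then have "outer_radius C + s = t * (inner_radius C + outer_radius C + 2 * s)"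
    by (simp add: algebra_simps)
  moreover have "inner_radius C + outer_radius C + 2 * s > 0"
    using centered_convex_radii[OF assms(1)] s by linarith
  ultimately show ?thesis
    unfolding s_def[symmetric] thinness_parallel[OF assms(1) s] by simp
qed

text \<open>The witness is the thinness of \<open>C + cball 0 s\<close>; it lies strictly inside the
  interval because the radii differ.\<close>

lemma parallel_radius_surj:
  assumes "centered_convex C" "s > 0" "inner_radius C < outer_radius C"
  obtains t where "t \<in> thinness_interval C" "parallel_radius C t = s"
proof -
  define r R where rR: "r = inner_radius C" "R = outer_radius C"
  have r: "0 \<le> r" "r < R" using centered_convex_radii[OF assms(1)] assms(3) by (auto simp: rR)
  define t where "t = (R + s) / (r + R + 2 * s)"
  have pos: "r + R + 2 * s > 0" "r + R > 0" using r assms(2) by linarith+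
  have "s * r < s * R" using r assms(2) by simp
  then have "t < R / (r + R)" using pos by (simp add: t_def field_simps)
  moreover have "1/2 < t" using pos r by (simp add: t_def field_simps)
  moreover have "2 * t - 1 = (R - r) / (r + R + 2 * s)" using pos by (simp add: t_def field_simps)
  moreover have "R - t * (r + R) = s * (R - r) / (r + R + 2 * s)" using pos
    by (simp add: t_def field_simps)
  ultimately have "t \<in> thinness_interval C" "parallel_radius C t = s"
    using r pos by (simp_all add: thinness_interval_def parallel_radius_def rR)
  with that show thesis by blast
qed

text \<open>These are the hypotheses of \<open>openin_lipschitz_vimage\<close> and
  \<open>measurable_lipschitz_curve\<close> for the curve of parallel bodies of
  \<open>C\<close>.\<close>

lemma parallel_curve:
  fixes C :: "'a::euclidean_space set"
  assumes "centered_convex C"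
  shows "continuous_on (thinness_interval C) (parallel_radius C)"
    and "t \<in> thinness_interval C \<Longrightarrow> C + cball 0 (parallel_radius C t) \<in> norm_bodies"
    and "t \<in> thinness_interval C \<Longrightarrow> t' \<in> thinness_interval C \<Longrightarrow>
      hausdorff_distance (C + cball 0 (parallel_radius C t)) (C + cball 0 (parallel_radius C t'))
        \<le> \<bar>parallel_radius C t - parallel_radius C t'\<bar>"
proof -
  show "continuous_on (thinness_interval C) (parallel_radius C)"
    unfolding parallel_radius_def
    by (intro continuous_intros) (auto simp: thinness_interval_def)
qed (use assms in \<open>auto intro!: norm_bodies_parallel hausdorff_distance_parallel parallel_radius_pos\<close>)

text \<open>For a segment \<open>E\<close> the parallel bodies of \<open>E\<close> attain every thinness in \<open>(1/2, 1)\<close>. They serve as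
  fallback where the parallel bodies of \<open>C\<close> do not attain the thinness \<open>t\<close>.\<close>

definition body_of_thinness :: "'a::euclidean_space set \<Rightarrow> 'a set \<Rightarrow> real \<Rightarrow> 'a set" where
  "body_of_thinness E C t =
    (if t \<in> thinness_interval C then C + cball 0 (parallel_radius C t)
     else if t \<in> thinness_interval E then E + cball 0 (parallel_radius E t)
     else {0} + cball 0 1)"

lemma thinness_interval_segment:
  fixes e :: "'a::euclidean_space"
  assumes "DIM('a) \<ge> 2" "e \<noteq> 0"
  shows "thinness_interval (closed_segment (- e) e) = {1/2<..<1}"
  using assms by (simp add: thinness_interval_def outer_radius_segment inner_radius_segment)

lemma body_of_thinness_properties:
  fixes C E :: "'a::euclidean_space set"
  assumes dim: "DIM('a) \<ge> 2" and C: "centered_convex C" and E: "centered_convex E"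
    and I: "thinness_interval E = {1/2<..<1}" and t: "t \<in> {1/2..<1}"
  shows "body_of_thinness E C t \<in> norm_bodies \<and> smooth_body (body_of_thinness E C t)
    \<and> thinness (body_of_thinness E C t) = t"
proof -
  \<comment> \<open>The only value of \<open>t\<close> that the segment cannot supply is 1/2, the
    thinness of the unit ball. Writing that ball as a parallel body of the degenerate segment
    \<open>{0}\<close> lets the same lemmas cover it.\<close>
  have 0: "centered_convex {0 :: 'a}" using centered_convex_segment[of "0::'a"] by simp
  have "outer_radius {0 :: 'a} = 0" "inner_radius {0 :: 'a} = 0"
    using outer_radius_segment[of "0::'a"] inner_radius_segment[OF dim, of 0] by simp_all
  then have "thinness ({0} + cball (0::'a) 1) = 1/2" using thinness_parallel[OF 0, of 1] by simp
  then have "thinness ({0} + cball (0::'a) 1) = t" if "t \<notin> thinness_interval E" using that t I by auto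
  then show ?thesis
    unfolding body_of_thinness_def
    using norm_bodies_parallel[OF 0, of 1] smooth_body_parallel[OF 0, of 1]
      norm_bodies_parallel[OF C parallel_radius_pos[OF C]] smooth_body_parallel[OF C parallel_radius_pos[OF C]]
      norm_bodies_parallel[OF E parallel_radius_pos[OF E]] smooth_body_parallel[OF E parallel_radius_pos[OF E]]
      thinness_parallel_radius[OF C] thinness_parallel_radius[OF E]
    by simp
qed

text \<open>The parameter interval splits into three Borel pieces: on \<open>A\<close> and
  \<open>B\<close> the map is a continuous curve of parallel bodies, and the last piece is a single
  point.\<close>

lemma body_of_thinness_measurable:
  fixes C E :: "'a::euclidean_space set"
  assumes dim: "DIM('a) \<ge> 2" and C: "centered_convex C" and E: "centered_convex E"
    and I: "thinness_interval E = {1/2<..<1}"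
  shows "body_of_thinness E C \<in> measurable (restrict_space borel {1/2..<1}) borel_norm_bodies"
proof -
  let ?J = "{1/2..<1::real}"
  define A where "A = ?J \<inter> thinness_interval C"
  define B where "B = {1/2<..<1} - thinness_interval C"
  have AB: "A \<in> sets borel" "B \<in> sets borel" "A \<subseteq> ?J" "B \<subseteq> ?J"
    by (auto simp: A_def B_def thinness_interval_def)
  have curve: "(\<lambda>t. D + cball 0 (parallel_radius D t)) \<in> measurable (restrict_space borel S) borel_norm_bodies"
    if "centered_convex D" "S \<subseteq> thinness_interval D" for D :: "'a set" and S
    using that(2) by (intro measurable_lipschitz_curve[of S "parallel_radius D"] parallel_curve(2,3)[OF that(1)]
      continuous_on_subset[OF parallel_curve(1)[OF that(1)]]) auto
  have "body_of_thinness E C \<in> measurable (restrict_space (restrict_space borel ?J) \<Omega>) borel_norm_bodies"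
    if cases: "\<Omega> \<in> {A, B, {1/2}}" for \<Omega>
  proof -
    have \<Omega>: "\<Omega> \<in> sets borel" "\<Omega> \<subseteq> ?J" using cases AB by auto
    have "body_of_thinness E C \<in> measurable (restrict_space borel \<Omega>) borel_norm_bodies"
    proof -
      consider "\<Omega> = A" | "\<Omega> = B" | "\<Omega> = {1/2}" using cases by blast
      then show ?thesis
      proof cases
        case 1
        show ?thesis
          using curve[OF C, of \<Omega>] 1
          by (subst measurable_cong[where g = "\<lambda>t. C + cball 0 (parallel_radius C t)"])
            (auto simp: space_restrict_space A_def body_of_thinness_def)
      next
        case 2
        show ?thesis
          using curve[OF E, of \<Omega>] 2
          by (subst measurable_cong[where g = "\<lambda>t. E + cball 0 (parallel_radius E t)"])
            (auto simp: space_restrict_space B_def I body_of_thinness_def)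
      next
        case 3
        have "body_of_thinness E C (1/2) \<in> norm_bodies"
          using body_of_thinness_properties[OF dim C E I, of "1/2"] by simp
        moreover have "body_of_thinness E C t = body_of_thinness E C (1/2)"
          if "t \<in> space (restrict_space borel \<Omega>)" for t
          using that unfolding 3 space_restrict_space by (auto simp del: divide_eq_eq_numeral1 eq_divide_eq_numeral1)
        ultimately show ?thesis
          by (subst measurable_cong[where g = "\<lambda>t. body_of_thinness E C (1/2)"]) simp_all
      qed
    qed
    moreover have "restrict_space (restrict_space borel ?J) \<Omega> = restrict_space borel \<Omega>"
      using \<Omega> by (subst restrict_restrict_space) (auto simp: Int_absorb1)
    ultimately show ?thesis by simp
  qed
  then show ?thesis
  proof (rule measurable_piecewise_restrict[rotated -1])
    show "countable {A, B, {1/2}}" by simp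
    show "space (restrict_space borel ?J) \<subseteq> \<Union> {A, B, {1/2}}"
      by (auto simp: space_restrict_space A_def B_def)
    fix \<Omega> assume "\<Omega> \<in> {A, B, {1/2}}"
    then show "\<Omega> \<inter> space (restrict_space borel ?J) \<in> sets (restrict_space borel ?J)"
      using AB by (auto simp: space_restrict_space sets_restrict_space_iff)
  qed
qed

section \<open>The truncated normal law and the random body\<close>

definition truncated_normal :: "real \<Rightarrow> real measure" where
  "truncated_normal \<sigma> =
    restrict_space (uniform_measure (density lborel (normal_density (1/2) (\<sigma>/2))) {1/2..<1}) {1/2..<1}"

text \<open>The normal density is positive everywhere, and a nonempty open set contains an interval
  of positive length.\<close>

lemma truncated_normal_open_pos:
  assumes "\<sigma> > 0" "open T" "T \<noteq> {}" "T \<subseteq> {1/2..<1}"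
  shows "emeasure (truncated_normal \<sigma>) T > 0"
proof -
  let ?N = "density lborel (normal_density (1/2) (\<sigma>/2))"
  interpret N: prob_space ?N using assms by (intro prob_space_normal_density) auto
  have [measurable]: "T \<in> sets borel" using assms(2) by simp
  have "emeasure ?N T \<noteq> 0"
  proof
    assume "emeasure ?N T = 0"
    then have "AE x in lborel. x \<notin> T"
      using assms by (auto simp: emeasure_density nn_integral_0_iff_AE indicator_def
        less_imp_neq[OF normal_density_pos, symmetric] elim!: eventually_mono split: if_splits)
    then have null: "emeasure lborel T = 0"
      using assms(2) by (subst (asm) AE_iff_measurable[of T]) auto
    obtain x where "x \<in> T" using assms(3) by blast
    then obtain d where d: "d > 0" "cball x d \<subseteq> T" using assms(2) by (auto simp: open_contains_cball)
    then have "emeasure lborel {x - d..x + d} \<le> emeasure lborel T"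
      using assms(2) by (intro emeasure_mono) (auto simp: cball_eq_atLeastAtMost)
    with null d(1) show False by simp
  qed
  then show ?thesis
    using assms(2,4) N.emeasure_finite[of "{1/2..<1}"]
    by (auto simp: truncated_normal_def emeasure_restrict_space emeasure_uniform_measure Int_absorb1
      zero_less_iff_neq_zero ennreal_divide_eq_0_iff)
qed

theorem theorem3:
  fixes \<sigma> :: real
  assumes "DIM('a::euclidean_space) \<ge> 2" and "\<sigma> > 0"
  shows "\<exists>P :: 'a set measure.
    prob_space P \<and> sets P = sets borel_norm_bodies \<and>
    (\<forall>U. openin norm_space.mtopology U \<and> U \<noteq> {} \<longrightarrow> measure P U > 0) \<and>
    {K \<in> norm_bodies. polytope K} \<in> null_sets P \<and>
    {K \<in> norm_bodies. smooth_body K} \<in> sets P \<and>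
    measure P {K \<in> norm_bodies. smooth_body K} = 1 \<and>
    thinness \<in> measurable P (restrict_space borel {1/2..<1}) \<and>
    is_truncated_normal \<sigma> (distr P (restrict_space borel {1/2..<1}) thinness)"
proof -
  let ?J = "{1/2..<1::real}"
  let ?N = "truncated_normal \<sigma>"
  \<comment> \<open>The law of the index of the polytope; all that matters is that every natural
    number has positive weight.\<close>
  let ?Q = "measure_pmf (geometric_pmf (1/2))"
  obtain D :: "'a set" where D: "countable D" "\<And>U. open U \<Longrightarrow> U \<noteq> {} \<Longrightarrow> \<exists>y\<in>D. y \<in> U"
    using countable_dense_exists by blast
  \<comment> \<open>Generators are restricted to a countable dense set, so there are only countably
    many finite sets of them to enumerate.\<close>
  define \<F> where "\<F> = {F. finite F \<and> F \<subseteq> D}"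
  have \<F>: "countable \<F>" "\<F> \<noteq> {}" unfolding \<F>_def using countable_Collect_finite_subset[OF D(1)] by auto
  define C where "C i = symmetric_hull (from_nat_into \<F> i)" for i
  have C: "centered_convex (C i)" for i
    using from_nat_into[OF \<F>(2), of i] unfolding C_def \<F>_def by (intro centered_convex_symmetric_hull) auto
  obtain e :: 'a where e: "e \<noteq> 0" using vector_choose_size[of 1] by (metis norm_zero zero_neq_one zero_le_one)
  define E where "E = closed_segment (- e) e"
  have E: "centered_convex E" "thinness_interval E = {1/2<..<1}"
    unfolding E_def by (rule centered_convex_segment thinness_interval_segment[OF assms(1) e])+
  define f where "f = (\<lambda>(i, t). body_of_thinness E (C i) t)"
  note f_props = body_of_thinness_properties[OF assms(1) C E]

  have trunc: "is_truncated_normal \<sigma> ?N"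
    unfolding truncated_normal_def by (rule is_truncated_normal_conditioned[OF assms(2)])
  then interpret N: prob_space ?N by (simp add: is_truncated_normal_def)
  have sets_N: "sets ?N = sets (restrict_space borel ?J)"
    using trunc by (simp add: is_truncated_normal_def)
  have space_N: "space ?N = ?J" using sets_eq_imp_space_eq[OF sets_N] by (simp add: space_restrict_space)
  interpret QN: pair_prob_space ?Q ?N by unfold_locales
  have space_QN: "space (?Q \<Otimes>\<^sub>M ?N) = UNIV \<times> ?J" by (simp add: space_pair_measure space_N)
  have f [measurable]: "f \<in> measurable (?Q \<Otimes>\<^sub>M ?N) borel_norm_bodies"
  proof -
    \<comment> \<open>The first coordinate is discrete, so measurability in \<open>t\<close> for
      each fixed index suffices.\<close>
    have "f \<in> measurable (count_space UNIV \<Otimes>\<^sub>M restrict_space borel ?J) borel_norm_bodies"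
      unfolding f_def using body_of_thinness_measurable[OF assms(1) C E]
      by (intro measurable_pair_measure_countable1) auto
    also have "measurable (count_space UNIV \<Otimes>\<^sub>M restrict_space borel ?J) borel_norm_bodies
        = measurable (?Q \<Otimes>\<^sub>M ?N) borel_norm_bodies"
      by (intro measurable_cong_sets sets_pair_measure_cong) (simp_all add: sets_N)
    finally show ?thesis .
  qed
  define P where "P = distr (?Q \<Otimes>\<^sub>M ?N) borel_norm_bodies f"
  have P: "prob_space P" unfolding P_def by (rule QN.prob_space_distr[OF f])
  then interpret P: prob_space P .
  have sets_P: "sets P = sets borel_norm_bodies" by (simp add: P_def)
  have thin: "thinness \<in> measurable P (restrict_space borel ?J)"
    using thinness_measurable measurable_cong_sets[OF sets_P refl] by blast

  have "measure P U > 0" if U: "openin norm_space.mtopology U" "U \<noteq> {}" for U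
  proof -
    obtain F s where F: "finite F" "F \<subseteq> D" "s > 0" "symmetric_hull F + cball 0 s \<in> U"
      "inner_radius (symmetric_hull F) < outer_radius (symmetric_hull F)"
      using open_contains_parallel_body[OF assms(1) U D(2)] by metis
    obtain i where i: "from_nat_into \<F> i = F"
      using from_nat_into_surj[OF \<F>(1), of F] F(1,2) by (auto simp: \<F>_def)
    then have Ci: "C i = symmetric_hull F" by (simp add: C_def)
    \<comment> \<open>The parameters at which the curve of parallel bodies of \<open>C i\<close>
      runs through \<open>U\<close>: a nonempty open set, so it has positive mass.\<close>
    define T where "T = {t \<in> thinness_interval (C i). C i + cball 0 (parallel_radius (C i) t) \<in> U}"
    obtain t where "t \<in> thinness_interval (C i)" "parallel_radius (C i) t = s"
      using parallel_radius_surj[OF C[of i] F(3)] F(5) unfolding Ci by blast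
    with F(4) have "t \<in> T" by (simp add: T_def Ci)
    have "openin (top_of_set (thinness_interval (C i))) T"
      unfolding T_def by (rule openin_lipschitz_vimage[OF U(1) parallel_curve[OF C]])
    then have "open T" by (simp add: openin_open_eq thinness_interval_def)
    have TJ: "T \<subseteq> ?J"
    proof -
      have "outer_radius (C i) / (inner_radius (C i) + outer_radius (C i)) \<le> 1"
        using centered_convex_radii[OF C[of i]] by (auto simp: divide_le_eq_1)
      then show ?thesis by (auto simp: T_def thinness_interval_def)
    qed
    have TN: "T \<in> sets ?N" using TJ \<open>open T\<close> by (simp add: sets_N sets_restrict_space_iff)
    have "0 < emeasure ?Q {i} * emeasure ?N T"
      using truncated_normal_open_pos[OF assms(2) \<open>open T\<close> _ TJ] \<open>t \<in> T\<close>
      by (auto simp: ennreal_zero_less_mult_iff emeasure_pmf_single set_pmf_geometric pmf_positive)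
    also have "\<dots> = emeasure (?Q \<Otimes>\<^sub>M ?N) ({i} \<times> T)"
      using TN by (intro N.emeasure_pair_measure_Times[symmetric]) auto
    also have "\<dots> \<le> emeasure (?Q \<Otimes>\<^sub>M ?N) (f -` U \<inter> space (?Q \<Otimes>\<^sub>M ?N))"
    proof (rule emeasure_mono)
      show "{i} \<times> T \<subseteq> f -` U \<inter> space (?Q \<Otimes>\<^sub>M ?N)"
        using TJ by (auto simp: space_QN f_def body_of_thinness_def T_def)
    qed (use open_in_borel_norm_bodies[OF U(1)] measurable_sets[OF f] in blast)
    also have "\<dots> = emeasure P U"
      unfolding P_def using open_in_borel_norm_bodies[OF U(1)] by (intro emeasure_distr[symmetric] f)
    finally show ?thesis by (simp add: P.emeasure_eq_measure)
  qed
  moreover have smooth: "{K \<in> norm_bodies. smooth_body K} \<in> sets P"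
    using smooth_bodies_measurable by (simp add: sets_P)
  moreover have smooth_1: "measure P {K \<in> norm_bodies. smooth_body K} = 1"
  proof -
    have "f -` {K \<in> norm_bodies. smooth_body K} \<inter> space (?Q \<Otimes>\<^sub>M ?N) = space (?Q \<Otimes>\<^sub>M ?N)"
      using f_props by (auto simp: space_QN f_def)
    then show ?thesis
      unfolding P_def using smooth_bodies_measurable
      by (subst measure_distr[OF f]) (simp_all add: QN.prob_space)
  qed
  \<comment> \<open>No polytope is smooth, so the polytopes lie in the complement of a set of full
    measure.\<close>
  moreover have "{K \<in> norm_bodies. polytope K} \<in> null_sets P"
  proof (rule null_sets_subset)
    show "space P - {K \<in> norm_bodies. smooth_body K} \<in> null_sets P"
      using P.prob_compl[OF smooth] smooth_1 smooth by (auto intro!: null_setsI simp: P.emeasure_eq_measure)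
    show "{K \<in> norm_bodies. polytope K} \<in> sets P" using polytopes_measurable by (simp add: sets_P)
    show "{K \<in> norm_bodies. polytope K} \<subseteq> space P - {K \<in> norm_bodies. smooth_body K}"
      using polytope_not_smooth[OF assms(1)] by (auto simp: P_def)
  qed
  moreover have "distr P (restrict_space borel ?J) thinness = ?N"
  proof -
    have "distr P (restrict_space borel ?J) thinness = distr (?Q \<Otimes>\<^sub>M ?N) (restrict_space borel ?J) (thinness \<circ> f)"
      unfolding P_def by (rule distr_distr[OF thinness_measurable f])
    \<comment> \<open>The body built from \<open>(i, t)\<close> has thinness \<open>t\<close>, so
      its thinness is the second coordinate, whose law is the second marginal.\<close>
    also have "\<dots> = distr (?Q \<Otimes>\<^sub>M ?N) ?N snd"
      using f_props by (intro distr_cong) (auto simp: sets_N space_QN f_def)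
    also have "\<dots> = ?N"
    proof (rule measure_eqI)
      fix A assume "A \<in> sets (distr (?Q \<Otimes>\<^sub>M ?N) ?N snd)"
      then have A: "A \<in> sets ?N" by simp
      have "snd -` A \<inter> space (?Q \<Otimes>\<^sub>M ?N) = UNIV \<times> A"
        using sets.sets_into_space[OF A] by (auto simp: space_QN space_N)
      then show "emeasure (distr (?Q \<Otimes>\<^sub>M ?N) ?N snd) A = emeasure ?N A"
        using A N.emeasure_pair_measure_Times[of UNIV ?Q A] measure_pmf.emeasure_space_1[of "geometric_pmf (1/2)"]
        by (simp add: emeasure_distr)
    qed simp
    finally show ?thesis .
  qed
  ultimately show ?thesis using P sets_P thin trunc by (intro exI[of _ P]) simp
qed

end
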